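(* Let $\mathbb{A}_n^m=S\oplus_s\mathcal N$ be a finite-dimensional commutative associative unital complex algebra with a Cartan basis $\{I_k\}_{k=1}^n$. Let $1$, $e_2=\sum_{r=1}^n a_rI_r$, $e_3=\sum_{r=1}^n b_rI_r$ $(a_r,b_r\in\mathbb{C})$ be vectors of $\mathbb{A}_n^m$ which are linearly independent over $\mathbb{R}$ and satisfy the characteristic equation $\mathcal{X}(1,e_2,e_3)=0$. Suppose that $f_u(E_3)=\mathbb{C}$ for all $u=1,\dots,m$. Let $\Phi:\Pi_\zeta\to\mathbb{A}_n^m$ be a function of the variable $\zeta=x+ye_2+ze_3$, monogenic in a domain $\Pi_\zeta\subset E_3$ of the form $\Pi_\zeta=\bigcap_{u=1}^m\Pi_\zeta(u)$ described in the context, and put $\Phi_u(\zeta):=I_u\Phi(\zeta)$. Then for every $u\in\{1,\dots,m\}$, in the algebra $\mathbb{A}_{n-m+1}^1=1\oplus_s\mathcal N$ (with the same nilpotent subalgebra $\mathcal N$) there exists the triple of vectors $$\widetilde e_1(u)=1,\qquad \widetilde e_2(u)=a_u+I_u\,\mathrm{Rad}\,e_2,\qquad \widetilde e_3(u)=b_u+I_u\,\mathrm{Rad}\,e_3,$$ which satisfies the characteristic equation $\mathcal{X}(1,\widetilde e_2(u),\widetilde e_3(u))=0$, and there exists a function $\widetilde\Phi_u:\widetilde\Pi_{\widetilde\zeta(u)}\to\mathbb{A}_{n-m+1}^1$ of the variable $\widetilde\zeta(u)=x+y\widetilde e_2(u)+z\widetilde e_3(u)$, monogenic in the cylinder $$\widetilde\Pi_{\widetilde\zeta(u)}=\left\{\widetilde\zeta(u)\in\widetilde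 E_3(u)\,:\, f_u\big(\widetilde\zeta(u)\big)=f_u(\zeta),\ \zeta\in\Pi_\zeta(u)\right\}$$ (that is, the set of $w\in\widetilde E_3(u)$ with $f_u(w)=f_u(\zeta)$ for some $\zeta\in\Pi_\zeta(u)$), such that $$\Phi_u(\zeta)=I_u\,\widetilde\Phi_u\big(\widetilde\zeta(u)\big)$$ for all $\zeta=x+ye_2+ze_3\in\Pi_\zeta$, where $\widetilde\zeta(u)=x+y\widetilde e_2(u)+z\widetilde e_3(u)$ has the same coordinates $x,y,z\in\mathbb{R}$ as $\zeta$.
   Context: **Algebra.** Let $m\le n$ be positive integers. $\mathbb{A}_n^m$ is a commutative associative algebra with unit over $\mathbb{C}$, with a (Cartan) basis $\{I_k\}_{k=1}^n$ satisfying: 1. for $r,s\in\{1,\dots,m\}$: $I_rI_s=0$ if $r\ne s$, and $I_rI_r=I_r$; 2. for $r,s\in\{m+1,\dots,n\}$: $I_rI_s=\sum_{k=\max\{r,s\}+1}^n\Upsilon_{r,k}^sI_k$ with constants $\Upsilon_{r,k}^s\in\mathbb{C}$; 3. for each $s\in\{m+1,\dots,n\}$ there is a unique $u_s\in\{1,\dots,m\}$ such that for all $r\in\{1,\dots,m\}$: $I_rI_s=I_s$ if $r=u_s$ and $I_rI_s=0$ if $r\neq u_s$. The unit is $1=\sum_{u=1}^mI_u$. $S$ is the subalgebra spanned by $I_1,\dots,I_m$ (semisimple) and $\mathcal N$ the subalgebra spanned by $I_{m+1},\dots,I_n$ (nilpotent); one writes $\mathbb{A}_n^m=S\oplus_s\mathcal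 N$. $\mathbb{A}_{n-m+1}^1=1\oplus_s\mathcal N$ denotes the subalgebra of $\mathbb{A}_n^m$ with basis $\{1,I_{m+1},\dots,I_n\}$. The linear functionals $f_u:\mathbb{A}_n^m\to\mathbb{C}$, $u=1,\dots,m$, are given by $f_u\big(\sum_{k=1}^n\lambda_kI_k\big)=\lambda_u$; they are continuous and multiplicative. The same symbol denotes the restriction of $f_u$ to $\mathbb{A}_{n-m+1}^1$ (where it is the unique multiplicative functional with $f_u(1)=1$ and kernel $\mathcal N$). For $e_2=\sum_{r=1}^n a_rI_r$, $e_3=\sum_{r=1}^n b_rI_r$ put $\mathrm{Rad}\,e_2:=\sum_{r=m+1}^na_rI_r$, $\mathrm{Rad}\,e_3:=\sum_{r=m+1}^nb_rI_r$. **Characteristic polynomial.** Fix a positive integer $N$ and real coefficients $C_{\alpha,\beta,\gamma}$ (for non-negative integers $\alpha,\beta,\gamma$ with $\alpha+\beta+\gamma=N$), and put $\mathcal{X}(p,q,r):=\sum_{\alpha+\beta+\gamma=N}C_{\alpha,\beta,\gamma}\,p^\alpha q^\beta r^\gamma$. **Monogenic functions.** $E_3:=\{\zeta=x+ye_2+ze_3: x,y,z\in\mathbb{R}\}$ and $\widetilde E_3(u):=\{\widetilde\zeta(u)=x+y\widetilde e_2(u)+z\widetilde e_3(u): x,y,z\in\mathbb{R}\}$. For $E$ one of these real linear spaces, $\mathbb{A}$ the corresponding algebra ($\mathbb{A}_n^m$ for $E_3$, $\mathbb{A}_{n-m+1}^1$ for $\widetilde E_3(u)$) and a domain $\Omega'\subset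 E$, a continuous function $\Phi:\Omega'\to\mathbb{A}$ is monogenic in $\Omega'$ if for every $\zeta\in\Omega'$ there is an element $\Phi'(\zeta)\in\mathbb{A}$ such that $\lim_{\varepsilon\to0+0}\big(\Phi(\zeta+\varepsilon h)-\Phi(\zeta)\big)\varepsilon^{-1}=h\,\Phi'(\zeta)$ for all $h\in E$. **The domain $\Pi_\zeta$.** For $u=1,\dots,m$ let $L_u\subset\mathbb{R}^3$ be the line $x+y\,\mathrm{Re}\,a_u+z\,\mathrm{Re}\,b_u=0$, $y\,\mathrm{Im}\,a_u+z\,\mathrm{Im}\,b_u=0$. Let $\Omega\subset\mathbb{R}^3$ be a domain convex in the direction of each line $L_u$ (i.e. $\Omega$ contains every segment that is parallel to $L_u$ and has both endpoints in $\Omega$), $\Omega_\zeta:=\{x+ye_2+ze_3:(x,y,z)\in\Omega\}$ and $D_u:=f_u(\Omega_\zeta)\subset\mathbb{C}$. Put $\Pi_\zeta(u):=\{\zeta\in E_3: f_u(\zeta)\in D_u\}$ (an infinite cylinder parallel to $L_u$) and $\Pi_\zeta:=\bigcap_{u=1}^m\Pi_\zeta(u)=\{\zeta\in E_3: f_u(\zeta)\in D_u,\ u=1,\dots,m\}$, which is assumed to be a domain. *)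

theory Defs
  imports "HOL-Analysis.Analysis"
begin

(* Commutative associative unital complex algebras.  The norm only provides the topology: on a
   finite-dimensional space all norms are equivalent, so it is no additional datum.  It need not be
   submultiplicative (the Euclidean norm of the coordinates, for example, need not be). *)
class complex_comm_algebra_1 = real_normed_vector + comm_ring_1 +
  fixes scaleC :: "complex \<Rightarrow> 'a \<Rightarrow> 'a"  (infixr "*\<^sub>C" 75)
  assumes scaleC_add_right: "c *\<^sub>C (x + y) = c *\<^sub>C x + c *\<^sub>C y"
    and scaleC_add_left: "(c + d) *\<^sub>C x = c *\<^sub>C x + d *\<^sub>C x"
    and scaleC_scaleC: "c *\<^sub>C d *\<^sub>C x = (c * d) *\<^sub>C x"
    and scaleC_one: "1 *\<^sub>C x = x"
    and scaleC_mult_left: "(c *\<^sub>C x) * y = c *\<^sub>C (x * y)"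
    and scaleR_eq_scaleC: "r *\<^sub>R x = complex_of_real r *\<^sub>C x"

interpretation cvec: vector_space "scaleC :: complex \<Rightarrow> 'a::complex_comm_algebra_1 \<Rightarrow> 'a"
  by unfold_locales (simp_all add: scaleC_add_right scaleC_add_left scaleC_scaleC scaleC_one)

(* The algebra A_n^m is the whole type.  That the unit is I 1 + ... + I m follows from the axioms. *)
definition cartan_basis :: "nat \<Rightarrow> nat \<Rightarrow> (nat \<Rightarrow> 'a::complex_comm_algebra_1) \<Rightarrow> bool" where
  "cartan_basis n m I \<longleftrightarrow>
     1 \<le> m \<and> m \<le> n \<and>
     inj_on I {1..n} \<and> cvec.independent (I ` {1..n}) \<and> cvec.span (I ` {1..n}) = UNIV \<and>
     (\<forall>r\<in>{1..m}. \<forall>s\<in>{1..m}. I r * I s = (if r = s then I r else 0)) \<and>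
     (\<exists>\<Upsilon> :: nat \<Rightarrow> nat \<Rightarrow> nat \<Rightarrow> complex. \<forall>r\<in>{m+1..n}. \<forall>s\<in>{m+1..n}.
        I r * I s = (\<Sum>k=max r s + 1..n. \<Upsilon> r s k *\<^sub>C I k)) \<and>
     (\<forall>s\<in>{m+1..n}. \<exists>!u. u \<in> {1..m} \<and>
        (\<forall>r\<in>{1..m}. I r * I s = (if r = u then I s else 0)))"

(* For u in {1..m} this is the functional f_u. *)
definition coord :: "nat \<Rightarrow> (nat \<Rightarrow> 'a::complex_comm_algebra_1) \<Rightarrow> nat \<Rightarrow> 'a \<Rightarrow> complex" where
  "coord n I u x = cvec.representation (I ` {1..n}) x (I u)"

definition Rad :: "nat \<Rightarrow> nat \<Rightarrow> (nat \<Rightarrow> 'a::complex_comm_algebra_1) \<Rightarrow> 'a \<Rightarrow> 'a" where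
  "Rad n m I x = (\<Sum>r=m+1..n. coord n I r x *\<^sub>C I r)"

(* The subalgebra A_{n-m+1}^1. *)
definition unital_nil_subalgebra :: "nat \<Rightarrow> nat \<Rightarrow> (nat \<Rightarrow> 'a::complex_comm_algebra_1) \<Rightarrow> 'a set" where
  "unital_nil_subalgebra n m I = cvec.span (insert 1 (I ` {m+1..n}))"

definition char_poly3 ::
  "nat \<Rightarrow> (nat \<Rightarrow> nat \<Rightarrow> nat \<Rightarrow> real) \<Rightarrow> 'a::complex_comm_algebra_1 \<Rightarrow> 'a \<Rightarrow> 'a \<Rightarrow> 'a" where
  "char_poly3 N C p q r =
     (\<Sum>(\<alpha>, \<beta>, \<gamma>) \<in> {(\<alpha>, \<beta>, \<gamma>). \<alpha> + \<beta> + \<gamma> = N}. C \<alpha> \<beta> \<gamma> *\<^sub>R (p ^ \<alpha> * q ^ \<beta> * r ^ \<gamma>))"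

definition zvar :: "'a::complex_comm_algebra_1 \<Rightarrow> 'a \<Rightarrow> real \<times> real \<times> real \<Rightarrow> 'a" where
  "zvar p q = (\<lambda>(x, y, z). x *\<^sub>R 1 + y *\<^sub>R p + z *\<^sub>R q)"

definition E3 :: "'a::complex_comm_algebra_1 \<Rightarrow> 'a \<Rightarrow> 'a set" where
  "E3 p q = range (zvar p q)"

definition domain_in :: "'a::topological_space set \<Rightarrow> 'a set \<Rightarrow> bool" where
  "domain_in E U \<longleftrightarrow> openin (top_of_set E) U \<and> connected U \<and> U \<noteq> {}"

(* A is the algebra of values, E the real linear space containing the domain U.  Since U is open in
   E, the values of the total function Phi outside U do not matter. *)
definition monogenic_on ::
  "'a::complex_comm_algebra_1 set \<Rightarrow> 'a set \<Rightarrow> 'a set \<Rightarrow> ('a \<Rightarrow> 'a) \<Rightarrow> bool" where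
  "monogenic_on A E U \<Phi> \<longleftrightarrow>
     domain_in E U \<and> \<Phi> ` U \<subseteq> A \<and> continuous_on U \<Phi> \<and>
     (\<forall>\<zeta>\<in>U. \<exists>d\<in>A. \<forall>h\<in>E.
        ((\<lambda>\<epsilon>::real. (\<Phi> (\<zeta> + \<epsilon> *\<^sub>R h) - \<Phi> \<zeta>) /\<^sub>R \<epsilon>) \<longlongrightarrow> h * d) (at_right 0))"

definition dir_line :: "complex \<Rightarrow> complex \<Rightarrow> (real \<times> real \<times> real) set" where
  "dir_line a b = {(x, y, z). x + y * Re a + z * Re b = 0 \<and> y * Im a + z * Im b = 0}"

(* L is a linear subspace, so the segment from p to q is parallel to L iff q - p lies in L. *)
definition convex_in_direction :: "'v::real_vector set \<Rightarrow> 'v set \<Rightarrow> bool" where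
  "convex_in_direction L U \<longleftrightarrow> (\<forall>p\<in>U. \<forall>q\<in>U. q - p \<in> L \<longrightarrow> closed_segment p q \<subseteq> U)"

definition cylinder :: "nat \<Rightarrow> (nat \<Rightarrow> 'a::complex_comm_algebra_1) \<Rightarrow> 'a \<Rightarrow> 'a \<Rightarrow>
    (real \<times> real \<times> real) set \<Rightarrow> nat \<Rightarrow> 'a set" where
  "cylinder n I e2 e3 \<Omega> u = {\<zeta> \<in> E3 e2 e3. coord n I u \<zeta> \<in> coord n I u ` zvar e2 e3 ` \<Omega>}"

end

(* The function I_u Phi depends, coordinate by coordinate, on holomorphic functions of f_u(zeta)
   alone.  Ordering the nilpotent basis elements as in the Cartan basis, the first coordinate of
   I_u Phi that has not been dealt with has directional derivatives f_u(h) d, hence is constant along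
   the lines parallel to L_u inside Omega and descends to a function on D_u.  That function is
   continuous and satisfies the Cauchy-Riemann equations pointwise, with no assumption on the
   continuity of the derivative, so it is holomorphic by the Looman-Menchoff theorem; the identity
   theorem carries the representation from Omega to all of Pi_zeta, although Pi_zeta itself need not be
   convex in the direction of L_u.  Subtracting the Taylor extension of this holomorphic function
   (zeta = w + nu with nu nilpotent) makes one more coordinate vanish.  The sum of the Taylor
   extensions makes sense on the whole cylinder over D_u.

   The Looman-Menchoff theorem is obtained without measure theory.  For each eps > 0 the boundary
   integral over a rectangle is bounded by 80 eps times the area near every point: otherwise the
   exceptional set contains, by Baire, a portion on which the difference quotients along the axes are
   eps-constant at a uniform scale, and a rectangle all of whose sides touch this portion has a small
   boundary integral. *)
theory Submission
  imports Defs "HOL-Complex_Analysis.Conformal_Mappings"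
begin

text \<open>The new vectors are dictated by one identity: I_u annihilates every basis idempotent
  other than itself, so multiplication by I_u cannot distinguish \<zeta> from the new variable with
  the same coordinates. The characteristic equation and the directional derivatives are both
  transferred through this identity. The coordinatewise argument rests on the Cartan order:
  multiplication by a nilpotent element moves strictly upwards in it, so in the first coordinate not
  yet cleared a direction h acts only through f_u(h). This requires the lower coordinates of the
  derivative itself to vanish; the direction 1 lies in the space and exhibits the derivative as a
  limit of difference quotients, which settles this. Origin of 80: if all four sides touch the
  portion and have length at most L, the boundary integral is at most 40 eps L^2, and L^2 is at most
  twice the area when no side exceeds twice the other. Thinner rectangles have to be cut. The norm
  is arbitrary and need not be submultiplicative, so continuity of coordinates and products is first
  derived from compactness in the space of coefficients.\<close>

section \<open>Boundary integrals over rectangles\<close>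

text \<open>This is the counterclockwise contour integral over the boundary. Opposite sides share an
  integrand, so that it can be estimated by the change of \<open>f\<close> across the
  rectangle.\<close>

definition rect_integral :: "(complex \<Rightarrow> complex) \<Rightarrow> real \<Rightarrow> real \<Rightarrow> real \<Rightarrow> real \<Rightarrow> complex" where
  "rect_integral f a b c d =
     integral {a..b} (\<lambda>x. f (Complex x c) - f (Complex x d)) +
     \<i> * integral {c..d} (\<lambda>y. f (Complex b y) - f (Complex a y))"

abbreviation rect :: "real \<Rightarrow> real \<Rightarrow> real \<Rightarrow> real \<Rightarrow> complex set" where
  "rect a b c d \<equiv> cbox (Complex a c) (Complex b d)"

lemma mem_rect: "z \<in> rect a b c d \<longleftrightarrow> a \<le> Re z \<and> Re z \<le> b \<and> c \<le> Im z \<and> Im z \<le> d"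
  by (simp add: in_cbox_complex_iff)

lemma rect_mono: "a \<le> a' \<Longrightarrow> b' \<le> b \<Longrightarrow> c \<le> c' \<Longrightarrow> d' \<le> d \<Longrightarrow> rect a' b' c' d' \<subseteq> rect a b c d"
  by (auto simp: mem_rect)

lemma continuous_on_Complex [continuous_intros]:
  "continuous_on S f \<Longrightarrow> continuous_on S g \<Longrightarrow> continuous_on S (\<lambda>x. Complex (f x) (g x))"
  unfolding Complex_eq by (intro continuous_intros)

lemma
  fixes f :: "complex \<Rightarrow> complex"
  assumes "continuous_on (rect a b c d) f"
  shows integrable_rect_horizontal:
      "\<And>t. c \<le> t \<Longrightarrow> t \<le> d \<Longrightarrow> (\<lambda>x. f (Complex x t)) integrable_on {a..b}"
    and integrable_rect_vertical:
      "\<And>t. a \<le> t \<Longrightarrow> t \<le> b \<Longrightarrow> (\<lambda>y. f (Complex t y)) integrable_on {c..d}"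
proof -
  show "(\<lambda>x. f (Complex x t)) integrable_on {a..b}" if "c \<le> t" "t \<le> d" for t
    by (intro integrable_continuous_real continuous_on_compose2[OF assms] continuous_intros)
      (use that in \<open>auto simp: mem_rect\<close>)
  show "(\<lambda>y. f (Complex t y)) integrable_on {c..d}" if "a \<le> t" "t \<le> b" for t
    by (intro integrable_continuous_real continuous_on_compose2[OF assms] continuous_intros)
      (use that in \<open>auto simp: mem_rect\<close>)
qed

lemma rect_integral_split_Re:
  assumes f: "continuous_on (rect a b c d) f" and "a \<le> t" "t \<le> b" "c \<le> d"
  shows "rect_integral f a b c d = rect_integral f a t c d + rect_integral f t b c d"
proof -
  note h = integrable_rect_horizontal[OF f] and v = integrable_rect_vertical[OF f]
  have "integral {a..b} (\<lambda>x. f (Complex x c) - f (Complex x d)) =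
     integral {a..t} (\<lambda>x. f (Complex x c) - f (Complex x d)) +
     integral {t..b} (\<lambda>x. f (Complex x c) - f (Complex x d))"
    by (rule Henstock_Kurzweil_Integration.integral_combine[symmetric]) (use assms h in \<open>auto intro!: Henstock_Kurzweil_Integration.integrable_diff\<close>)
  moreover have "integral {c..d} (\<lambda>y. f (Complex b y) - f (Complex a y)) =
     integral {c..d} (\<lambda>y. f (Complex t y) - f (Complex a y)) +
     integral {c..d} (\<lambda>y. f (Complex b y) - f (Complex t y))"
    using assms v by (simp add: Henstock_Kurzweil_Integration.integral_diff Henstock_Kurzweil_Integration.integrable_diff)
  ultimately show ?thesis
    by (simp add: rect_integral_def algebra_simps)
qed

lemma rect_integral_split_Im:
  assumes f: "continuous_on (rect a b c d) f" and "c \<le> t" "t \<le> d" "a \<le> b"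
  shows "rect_integral f a b c d = rect_integral f a b c t + rect_integral f a b t d"
proof -
  note h = integrable_rect_horizontal[OF f] and v = integrable_rect_vertical[OF f]
  have "integral {c..d} (\<lambda>y. f (Complex b y) - f (Complex a y)) =
     integral {c..t} (\<lambda>y. f (Complex b y) - f (Complex a y)) +
     integral {t..d} (\<lambda>y. f (Complex b y) - f (Complex a y))"
    by (rule Henstock_Kurzweil_Integration.integral_combine[symmetric]) (use assms v in \<open>auto intro!: Henstock_Kurzweil_Integration.integrable_diff\<close>)
  moreover have "integral {a..b} (\<lambda>x. f (Complex x c) - f (Complex x d)) =
     integral {a..b} (\<lambda>x. f (Complex x c) - f (Complex x t)) +
     integral {a..b} (\<lambda>x. f (Complex x t) - f (Complex x d))"
    using assms h by (simp add: Henstock_Kurzweil_Integration.integral_diff Henstock_Kurzweil_Integration.integrable_diff)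
  ultimately show ?thesis
    by (simp add: rect_integral_def algebra_simps)
qed

text \<open>The two pairs of opposite sides contribute opposite amounts for the function k z. This
  allows a common slope to be removed before the integral is estimated by oscillation.\<close>

lemma rect_integral_sub_linear:
  assumes f: "continuous_on (rect a b c d) f" and "a \<le> b" "c \<le> d"
  shows "rect_integral (\<lambda>z. f z - k * z) a b c d = rect_integral f a b c d"
proof -
  note h = integrable_rect_horizontal[OF f] and v = integrable_rect_vertical[OF f]
  have "integral {a..b} (\<lambda>x. (f (Complex x c) - k * Complex x c) - (f (Complex x d) - k * Complex x d)) =
        integral {a..b} (\<lambda>x. (f (Complex x c) - f (Complex x d)) + k * (\<i> * (d - c)))"
    by (intro integral_cong) (simp add: Complex_eq algebra_simps)
  also have "\<dots> = integral {a..b} (\<lambda>x. f (Complex x c) - f (Complex x d)) + (b - a) * (k * (\<i> * (d - c)))"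
    using assms h by (subst Henstock_Kurzweil_Integration.integral_add) (auto intro!: Henstock_Kurzweil_Integration.integrable_diff simp: scaleR_conv_of_real)
  finally have 1: "integral {a..b} (\<lambda>x. (f (Complex x c) - k * Complex x c) - (f (Complex x d) - k * Complex x d)) = \<dots>" .
  have "integral {c..d} (\<lambda>y. (f (Complex b y) - k * Complex b y) - (f (Complex a y) - k * Complex a y)) =
        integral {c..d} (\<lambda>y. (f (Complex b y) - f (Complex a y)) - k * (b - a))"
    by (intro integral_cong) (simp add: Complex_eq algebra_simps)
  also have "\<dots> = integral {c..d} (\<lambda>y. f (Complex b y) - f (Complex a y)) - (d - c) * (k * (b - a))"
    using assms v by (subst Henstock_Kurzweil_Integration.integral_diff) (auto intro!: Henstock_Kurzweil_Integration.integrable_diff simp: scaleR_conv_of_real)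
  finally have 2: "integral {c..d} (\<lambda>y. (f (Complex b y) - k * Complex b y) - (f (Complex a y) - k * Complex a y)) = \<dots>" .
  show ?thesis
    unfolding rect_integral_def 1 2 by (simp add: algebra_simps)
qed

lemma norm_rect_integral_le:
  assumes f: "continuous_on (rect a b c d) f" and "a \<le> b" "c \<le> d"
    and "\<And>x. a \<le> x \<Longrightarrow> x \<le> b \<Longrightarrow> norm (f (Complex x c) - f (Complex x d)) \<le> B"
    and "\<And>y. c \<le> y \<Longrightarrow> y \<le> d \<Longrightarrow> norm (f (Complex b y) - f (Complex a y)) \<le> B"
  shows "norm (rect_integral f a b c d) \<le> B * ((b - a) + (d - c))"
proof -
  have "norm (integral {a..b} (\<lambda>x. f (Complex x c) - f (Complex x d))) \<le> B * (b - a)"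
    by (intro integral_bound continuous_on_diff continuous_on_compose2[OF f] continuous_intros)
       (use assms in \<open>auto simp: mem_rect\<close>)
  moreover have "norm (integral {c..d} (\<lambda>y. f (Complex b y) - f (Complex a y))) \<le> B * (d - c)"
    by (intro integral_bound continuous_on_diff continuous_on_compose2[OF f] continuous_intros)
       (use assms in \<open>auto simp: mem_rect\<close>)
  ultimately show ?thesis
    unfolding rect_integral_def
    by (intro order.trans[OF norm_triangle_ineq]) (simp add: norm_mult algebra_simps)
qed

lemma continuous_on_rect_integral_Re:
  assumes f: "continuous_on (rect a b c d) f" and "c \<le> d"
  shows "continuous_on {a..b} (\<lambda>t. rect_integral f a t c d)"
proof (cases "a \<le> b")
  case True
  note h = integrable_rect_horizontal[OF f]
  have "continuous_on {a..b} (\<lambda>t. integral (cbox c d) (\<lambda>y. f (Complex t y) - f (Complex a y)))"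
    by (intro integral_continuous_on_param)
       (auto simp: mem_rect case_prod_unfold True
          intro!: continuous_intros continuous_on_compose2[OF f])
  then show ?thesis
    unfolding rect_integral_def using assms h
    by (intro continuous_intros indefinite_integral_continuous_1) (auto intro!: Henstock_Kurzweil_Integration.integrable_diff)
qed auto

lemma continuous_on_rect_integral_Im:
  assumes f: "continuous_on (rect a b c d) f" and "a \<le> b"
  shows "continuous_on {c..d} (\<lambda>t. rect_integral f a b c t)"
proof (cases "c \<le> d")
  case True
  note v = integrable_rect_vertical[OF f]
  have "continuous_on {c..d} (\<lambda>t. integral (cbox a b) (\<lambda>x. f (Complex x c) - f (Complex x t)))"
    by (intro integral_continuous_on_param)
       (auto simp: mem_rect case_prod_unfold True
          intro!: continuous_intros continuous_on_compose2[OF f])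
  then show ?thesis
    unfolding rect_integral_def using assms v
    by (intro continuous_intros indefinite_integral_continuous_1) (auto intro!: Henstock_Kurzweil_Integration.integrable_diff)
qed auto

lemma rect_integral_degenerate [simp]:
  "rect_integral f a a c d = 0" "rect_integral f a b c c = 0"
  by (simp_all add: rect_integral_def)

text \<open>The two paths along the axes from $z$ to $w$ give the same increment of $f$.  Estimating it by the
  slope $p$ on the legs starting at $z$ and by the slope $q$ on the legs ending at $w$, the
  difference is $(x - iy)(p - q)$, where $w - z = x + iy$.\<close>

lemma slopes_close:
  fixes f :: "complex \<Rightarrow> complex"
  assumes z: "norm (f (Complex (Re w) (Im z)) - f z - (Complex (Re w) (Im z) - z) * p)
                \<le> \<epsilon> * norm (Complex (Re w) (Im z) - z)"
      "norm (f (Complex (Re z) (Im w)) - f z - (Complex (Re z) (Im w) - z) * p)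
                \<le> \<epsilon> * norm (Complex (Re z) (Im w) - z)"
    and w: "norm (f (Complex (Re w) (Im z)) - f w - (Complex (Re w) (Im z) - w) * q)
                \<le> \<epsilon> * norm (Complex (Re w) (Im z) - w)"
      "norm (f (Complex (Re z) (Im w)) - f w - (Complex (Re z) (Im w) - w) * q)
                \<le> \<epsilon> * norm (Complex (Re z) (Im w) - w)"
    and "z \<noteq> w" "\<epsilon> \<ge> 0"
  shows "norm (p - q) \<le> 4 * \<epsilon>"
proof -
  define x y where "x = Re w - Re z" and "y = Im w - Im z"
  let ?u = "Complex (Re w) (Im z)" and ?v = "Complex (Re z) (Im w)"
  have uz: "?u - z = Complex x 0" and vz: "?v - z = Complex 0 y"
    and uw: "?u - w = Complex 0 (-y)" and vw: "?v - w = Complex (-x) 0"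
    by (simp_all add: complex_eq_iff x_def y_def)
  have n: "norm (Complex x 0) = \<bar>x\<bar>" "norm (Complex 0 y) = \<bar>y\<bar>"
    "norm (Complex 0 (-y)) = \<bar>y\<bar>" "norm (Complex (-x) 0) = \<bar>x\<bar>"
    by (simp_all add: complex_norm)
  have "Complex x (-y) \<noteq> 0"
    using \<open>z \<noteq> w\<close> by (auto simp: complex_eq_iff x_def y_def)
  define A B C D where "A = f ?u - f z - Complex x 0 * p" and "B = f ?u - f w - Complex 0 (-y) * q"
    and "C = f ?v - f z - Complex 0 y * p" and "D = f ?v - f w - Complex (-x) 0 * q"
  have ABCD: "norm A \<le> \<epsilon> * \<bar>x\<bar>" "norm B \<le> \<epsilon> * \<bar>y\<bar>" "norm C \<le> \<epsilon> * \<bar>y\<bar>" "norm D \<le> \<epsilon> * \<bar>x\<bar>"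
    using z w unfolding uz vz uw vw n A_def B_def C_def D_def by auto
  have "Complex x (-y) * (p - q) = - A + B + C - D"
    by (simp add: complex_eq_iff algebra_simps A_def B_def C_def D_def)
  then have "norm (Complex x (-y) * (p - q)) \<le> 2 * (\<epsilon> * \<bar>x\<bar>) + 2 * (\<epsilon> * \<bar>y\<bar>)"
    using ABCD norm_triangle_ineq4[of "- A + B + C" D] norm_triangle_ineq[of "- A + B" C]
      norm_triangle_ineq[of "- A" B] norm_minus_cancel[of A] by simp
  also have "\<dots> \<le> 4 * (\<epsilon> * norm (Complex x (-y)))"
    using mult_left_mono[OF abs_Re_le_cmod[of "Complex x (-y)"] \<open>\<epsilon> \<ge> 0\<close>]
      mult_left_mono[OF abs_Im_le_cmod[of "Complex x (-y)"] \<open>\<epsilon> \<ge> 0\<close>] by simp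
  finally have "norm (Complex x (-y)) * norm (p - q) \<le> norm (Complex x (-y)) * (4 * \<epsilon>)"
    by (simp add: norm_mult ac_simps)
  then show ?thesis
    using \<open>Complex x (-y) \<noteq> 0\<close> by simp
qed

text \<open>All slopes on \<open>K\<close> agree up to 4\<epsilon>, so after subtracting one of them
  the function changes by at most 5\<epsilon>L along an axis leg starting in \<open>K\<close>. Two
  points of \<open>K\<close> are joined by two such legs through a corner, at cost 10\<epsilon>L.
  Any point of a side is one leg away from the point of \<open>K\<close> on that side, so opposite
  points differ by at most (5 + 10 + 5)\<epsilon>L; the half perimeter is at most 2L.\<close>

lemma rect_integral_touching_bound:
  fixes f q :: "complex \<Rightarrow> complex"
  assumes f: "continuous_on (rect a b c d) f" and "a \<le> b" "c \<le> d" and K: "K \<subseteq> rect a b c d"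
    and l: "zl \<in> K" "Re zl = a" and r: "zr \<in> K" "Re zr = b"
    and bt: "zb \<in> K" "Im zb = c" and t: "zt \<in> K" "Im zt = d"
    and q: "\<And>z w. z \<in> K \<Longrightarrow> w \<in> rect a b c d \<Longrightarrow> Re w = Re z \<or> Im w = Im z \<Longrightarrow>
               norm (f w - f z - (w - z) * q z) \<le> \<epsilon> * norm (w - z)"
    and L: "b - a \<le> L" "d - c \<le> L" and "\<epsilon> \<ge> 0"
  shows "norm (rect_integral f a b c d) \<le> 40 * \<epsilon> * L^2"
proof -
  have Kb: "a \<le> Re z" "Re z \<le> b" "c \<le> Im z" "Im z \<le> d" if "z \<in> K" for z
    using K that by (auto simp: mem_rect)
  have slopes: "norm (q z - q w) \<le> 4 * \<epsilon>" if "z \<in> K" "w \<in> K" for z w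
  proof (cases "z = w")
    case False
    show ?thesis
      by (rule slopes_close[where f = f and z = z and w = w]; (rule q)?)
         (use False Kb that \<open>\<epsilon> \<ge> 0\<close> in \<open>auto simp: mem_rect\<close>)
  qed (use \<open>\<epsilon> \<ge> 0\<close> in auto)
  define g where "g z = f z - q zl * z" for z
  have g: "norm (g w - g z) \<le> 5 * \<epsilon> * norm (w - z)"
    if "z \<in> K" "w \<in> rect a b c d" "Re w = Re z \<or> Im w = Im z" for z w
  proof -
    have "g w - g z = (f w - f z - (w - z) * q z) + (w - z) * (q z - q zl)"
      by (simp add: g_def algebra_simps)
    also have "norm \<dots> \<le> \<epsilon> * norm (w - z) + norm (w - z) * (4 * \<epsilon>)"
      by (intro order.trans[OF norm_triangle_ineq] add_mono q that)
         (use that l slopes in \<open>auto simp: norm_mult intro!: mult_left_mono\<close>)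
    finally show ?thesis by (simp add: algebra_simps)
  qed
  have ax: "norm (g w - g z) \<le> 5 * \<epsilon> * L"
    if "z \<in> K" "w \<in> rect a b c d" "Re w = Re z \<or> Im w = Im z" for z w
  proof -
    have "norm (w - z) \<le> L"
      using Kb[OF that(1)] that(2,3) L by (auto simp: mem_rect cmod_def)
    then show ?thesis
      using g[OF that] \<open>\<epsilon> \<ge> 0\<close> by (meson mult_left_mono mult_nonneg_nonneg order.trans zero_le_numeral)
  qed
  have cross: "norm (g z - g w) \<le> 10 * \<epsilon> * L" if "z \<in> K" "w \<in> K" for z w
  proof -
    have "Complex (Re z) (Im w) \<in> rect a b c d"
      using Kb that by (auto simp: mem_rect)
    then have "norm (g (Complex (Re z) (Im w)) - g z) \<le> 5 * \<epsilon> * L"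
      "norm (g (Complex (Re z) (Im w)) - g w) \<le> 5 * \<epsilon> * L"
      using ax that by auto
    then show ?thesis
      using dist_triangle3[of "g z" "g w" "g (Complex (Re z) (Im w))"] by (simp add: dist_norm)
  qed
  have tri: "norm (x - w) \<le> norm (x - y) + norm (y - z) + norm (w - z)" for x y z w :: complex
    using dist_triangle[of x w y] dist_triangle2[of y w z] by (simp add: dist_norm)
  have "norm (rect_integral g a b c d) \<le> (20 * \<epsilon> * L) * ((b - a) + (d - c))"
  proof (rule norm_rect_integral_le)
    show "continuous_on (rect a b c d) g"
      unfolding g_def by (intro continuous_intros f)
    show "norm (g (Complex x c) - g (Complex x d)) \<le> 20 * \<epsilon> * L" if "a \<le> x" "x \<le> b" for x
    proof -
      have "norm (g (Complex x c) - g zb) \<le> 5 * \<epsilon> * L" "norm (g (Complex x d) - g zt) \<le> 5 * \<epsilon> * L"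
        using ax[OF bt(1), of "Complex x c"] ax[OF t(1), of "Complex x d"] bt t that \<open>c \<le> d\<close>
        by (auto simp: mem_rect)
      then show ?thesis
        using tri[of "g (Complex x c)" "g (Complex x d)" "g zb" "g zt"] cross[OF bt(1) t(1)] by linarith
    qed
    show "norm (g (Complex b y) - g (Complex a y)) \<le> 20 * \<epsilon> * L" if "c \<le> y" "y \<le> d" for y
    proof -
      have "norm (g (Complex b y) - g zr) \<le> 5 * \<epsilon> * L" "norm (g (Complex a y) - g zl) \<le> 5 * \<epsilon> * L"
        using ax[OF r(1), of "Complex b y"] ax[OF l(1), of "Complex a y"] l r that \<open>a \<le> b\<close>
        by (auto simp: mem_rect)
      then show ?thesis
        using tri[of "g (Complex b y)" "g (Complex a y)" "g zr" "g zl"] cross[OF r(1) l(1)] by linarith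
    qed
  qed fact+
  also have "\<dots> \<le> (20 * \<epsilon> * L) * (L + L)"
    using L \<open>\<epsilon> \<ge> 0\<close> \<open>a \<le> b\<close> by (intro mult_left_mono) auto
  also have "\<dots> = 40 * \<epsilon> * L^2"
    by (simp add: power2_eq_square)
  finally show ?thesis
    unfolding g_def by (simp add: rect_integral_sub_linear[OF f \<open>a \<le> b\<close> \<open>c \<le> d\<close>])
qed

section \<open>Area bounds for boundary integrals, and their extension across an exceptional
  set\<close>

definition rect_bound :: "(complex \<Rightarrow> complex) \<Rightarrow> real \<Rightarrow> complex set \<Rightarrow> bool" where
  "rect_bound f k V \<longleftrightarrow> (\<forall>a b c d. a \<le> b \<longrightarrow> c \<le> d \<longrightarrow> rect a b c d \<subseteq> V \<longrightarrow>
     norm (rect_integral f a b c d) \<le> k * ((b - a) * (d - c)))"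

lemma rect_boundD:
  "rect_bound f k V \<Longrightarrow> a \<le> b \<Longrightarrow> c \<le> d \<Longrightarrow> rect a b c d \<subseteq> V \<Longrightarrow>
     norm (rect_integral f a b c d) \<le> k * ((b - a) * (d - c))"
  by (simp add: rect_bound_def)

lemma rect_bound_subset: "rect_bound f k V \<Longrightarrow> W \<subseteq> V \<Longrightarrow> rect_bound f k W"
  unfolding rect_bound_def by blast

text \<open>A bound proportional to the area is additive under cuts, so it propagates by bisection,
  one coordinate at a time: first along a horizontal line to reach thin strips of full width, then
  vertically.\<close>

lemma rect_bound_local:
  assumes f: "continuous_on V f" and loc: "\<And>z. z \<in> V \<Longrightarrow> \<exists>r>0. rect_bound f k (ball z r)"
  shows "rect_bound f k V"
  unfolding rect_bound_def
proof (intro allI impI)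
  fix a b c d assume "a \<le> b" "c \<le> d" and sub: "rect a b c d \<subseteq> V"
  have cont: "continuous_on (rect a' b' c' d') f" if "a \<le> a'" "b' \<le> b" "c \<le> c'" "d' \<le> d" for a' b' c' d'
    by (intro continuous_on_subset[OF f] order.trans[OF rect_mono sub] that)
  \<comment> \<open>The admissible strip height \<open>e\<close> depends on the line and on the
    horizontal interval; when two intervals are joined the smaller height is kept.\<close>
  define Q where "Q y a' b' \<longleftrightarrow> (a \<le> a' \<longrightarrow> a' \<le> b' \<longrightarrow> b' \<le> b \<longrightarrow>
      (\<exists>e>0. \<forall>c' d'. c \<le> c' \<longrightarrow> c' \<le> y \<longrightarrow> y \<le> d' \<longrightarrow> d' \<le> d \<longrightarrow> d' - c' < e \<longrightarrow>
         norm (rect_integral f a' b' c' d') \<le> k * ((b' - a') * (d' - c'))))" for y a' b'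
  have QD: "\<exists>e>0. \<forall>c' d'. c \<le> c' \<longrightarrow> c' \<le> y \<longrightarrow> y \<le> d' \<longrightarrow> d' \<le> d \<longrightarrow> d' - c' < e \<longrightarrow>
         norm (rect_integral f a' b' c' d') \<le> k * ((b' - a') * (d' - c'))"
    if "Q y a' b'" "a \<le> a'" "a' \<le> b'" "b' \<le> b" for y a' b'
    using that unfolding Q_def by (elim impE)
  have Q: "Q y a b" if y: "c \<le> y" "y \<le> d" for y
    using \<open>a \<le> b\<close>
  proof (induction rule: Bolzano)
    case (trans a' t b')
    show ?case
      unfolding Q_def
    proof (intro impI)
      assume *: "a \<le> a'" "a' \<le> b'" "b' \<le> b"
      obtain e1 where e1: "e1 > 0" "\<And>c' d'. c \<le> c' \<Longrightarrow> c' \<le> y \<Longrightarrow> y \<le> d' \<Longrightarrow> d' \<le> d \<Longrightarrow> d' - c' < e1 \<Longrightarrow>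
         norm (rect_integral f a' t c' d') \<le> k * ((t - a') * (d' - c'))"
        using QD[OF trans(1) *(1) trans(3) order.trans[OF trans(4) *(3)]] by blast
      obtain e2 where e2: "e2 > 0" "\<And>c' d'. c \<le> c' \<Longrightarrow> c' \<le> y \<Longrightarrow> y \<le> d' \<Longrightarrow> d' \<le> d \<Longrightarrow> d' - c' < e2 \<Longrightarrow>
         norm (rect_integral f t b' c' d') \<le> k * ((b' - t) * (d' - c'))"
        using QD[OF trans(2) order.trans[OF *(1) trans(3)] trans(4) *(3)] by blast
      show "\<exists>e>0. \<forall>c' d'. c \<le> c' \<longrightarrow> c' \<le> y \<longrightarrow> y \<le> d' \<longrightarrow> d' \<le> d \<longrightarrow> d' - c' < e \<longrightarrow>
         norm (rect_integral f a' b' c' d') \<le> k * ((b' - a') * (d' - c'))"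
      proof (intro exI[of _ "min e1 e2"] conjI allI impI)
        fix c' d' assume h: "c \<le> c'" "c' \<le> y" "y \<le> d'" "d' \<le> d" "d' - c' < min e1 e2"
        have "norm (rect_integral f a' b' c' d') = norm (rect_integral f a' t c' d' + rect_integral f t b' c' d')"
          using rect_integral_split_Re[OF cont, of a' b' c' d' t] * h trans(3,4) by simp
        also have "\<dots> \<le> k * ((t - a') * (d' - c')) + k * ((b' - t) * (d' - c'))"
          using h by (intro order.trans[OF norm_triangle_ineq] add_mono e1 e2) auto
        finally show "norm (rect_integral f a' b' c' d') \<le> k * ((b' - a') * (d' - c'))"
          by (simp add: algebra_simps)
      qed (use e1 e2 in auto)
    qed
  next
    case (local x)
    then have "Complex x y \<in> V" using y sub by (auto simp: mem_rect)
    then obtain r where r: "r > 0" "rect_bound f k (ball (Complex x y) r)" using loc by blast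
    show ?case
    \<comment> \<open>With both side lengths below r/2, the real and imaginary distances to the
      centre add up to less than r.\<close>
    proof (intro exI[of _ "r / 2"] conjI allI impI)
      fix a' b' assume h: "a' \<le> x \<and> x \<le> b' \<and> b' - a' < r / 2"
      show "Q y a' b'"
        unfolding Q_def
      proof (intro impI exI[of _ "r / 2"] conjI allI)
        fix c' d' assume h': "c' \<le> y" "y \<le> d'" "d' - c' < r / 2"
        have "rect a' b' c' d' \<subseteq> ball (Complex x y) r"
        proof
          fix z assume "z \<in> rect a' b' c' d'"
          then have "\<bar>Re (z - Complex x y)\<bar> < r / 2" "\<bar>Im (z - Complex x y)\<bar> < r / 2"
            using h h' by (auto simp: mem_rect abs_if)
          then show "z \<in> ball (Complex x y) r"
            using cmod_le[of "z - Complex x y"] by (simp add: dist_norm norm_minus_commute)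
        qed
        then show "norm (rect_integral f a' b' c' d') \<le> k * ((b' - a') * (d' - c'))"
          using r h h' by (intro rect_boundD) auto
      qed (use r in auto)
    qed (use r in auto)
  qed
  define P where "P c' d' \<longleftrightarrow> (c \<le> c' \<longrightarrow> c' \<le> d' \<longrightarrow> d' \<le> d \<longrightarrow>
         norm (rect_integral f a b c' d') \<le> k * ((b - a) * (d' - c')))" for c' d'
  have "P c d"
    using \<open>c \<le> d\<close>
  proof (induction rule: Bolzano)
    case (trans c' t d')
    show ?case
      unfolding P_def
    proof (intro impI)
      assume *: "c \<le> c'" "c' \<le> d'" "d' \<le> d"
      have "norm (rect_integral f a b c' d') = norm (rect_integral f a b c' t + rect_integral f a b t d')"
        using rect_integral_split_Im[OF cont, of a b c' d' t] * \<open>a \<le> b\<close> trans(3,4) by simp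
      also have "\<dots> \<le> k * ((b - a) * (t - c')) + k * ((b - a) * (d' - t))"
        using trans * unfolding P_def by (intro order.trans[OF norm_triangle_ineq] add_mono) auto
      finally show "norm (rect_integral f a b c' d') \<le> k * ((b - a) * (d' - c'))"
        by (simp add: algebra_simps)
    qed
  next
    case (local y)
    then obtain e where "e > 0" "\<And>c' d'. c \<le> c' \<Longrightarrow> c' \<le> y \<Longrightarrow> y \<le> d' \<Longrightarrow> d' \<le> d \<Longrightarrow> d' - c' < e \<Longrightarrow>
         norm (rect_integral f a b c' d') \<le> k * ((b - a) * (d' - c'))"
      using QD[OF Q[OF local] order_refl \<open>a \<le> b\<close> order_refl] by blast
    then show ?case
      unfolding P_def by (intro exI[of _ e]) auto
  qed
  then show "norm (rect_integral f a b c d) \<le> k * ((b - a) * (d - c))"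
    using \<open>c \<le> d\<close> unfolding P_def by auto
qed

text \<open>The last side may touch the exceptional set, where no bound is available. The integral
  depends continuously on the position of that side, so the bound passes to the limit. The next
  three lemmas do the same for the other sides.\<close>

lemma rect_bound_right:
  assumes f: "continuous_on (rect a b c d) f" and W: "rect_bound f k W" and ab: "a \<le> b" "c \<le> d"
    and sub: "\<And>t. a \<le> t \<Longrightarrow> t < b \<Longrightarrow> rect a t c d \<subseteq> W"
  shows "norm (rect_integral f a b c d) \<le> k * ((b - a) * (d - c))"
proof (cases "a = b")
  case False
  then have cl: "closure {a..<b} = {a..b}" using ab by simp
  have "norm (rect_integral f a b c d) - k * ((b - a) * (d - c)) \<le> 0"
    by (rule continuous_le_on_closure[where S = "{a..<b}" and f = "\<lambda>t. norm (rect_integral f a t c d) - k * ((t - a) * (d - c))"])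
       (use ab sub rect_boundD[OF W] in \<open>auto simp only: cl diff_le_0_iff_le atLeastAtMost_iff atLeastLessThan_iff
          intro!: continuous_intros continuous_on_rect_integral_Re[OF f]\<close>)
  then show ?thesis by simp
qed auto

lemma rect_bound_left:
  assumes f: "continuous_on (rect a b c d) f" and W: "rect_bound f k W" and ab: "a \<le> b" "c \<le> d"
    and sub: "\<And>t. a < t \<Longrightarrow> t \<le> b \<Longrightarrow> rect t b c d \<subseteq> W"
  shows "norm (rect_integral f a b c d) \<le> k * ((b - a) * (d - c))"
proof (cases "a = b")
  case False
  then have cl: "closure {a<..b} = {a..b}" using ab by simp
  have "continuous_on {a..b} (\<lambda>t. rect_integral f a b c d - rect_integral f a t c d)"
    by (intro continuous_intros continuous_on_rect_integral_Re[OF f] ab)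
  then have cont: "continuous_on {a..b} (\<lambda>t. rect_integral f t b c d)"
    by (rule continuous_on_eq) (use rect_integral_split_Re[OF f] ab in auto)
  have "norm (rect_integral f a b c d) - k * ((b - a) * (d - c)) \<le> 0"
    by (rule continuous_le_on_closure[where S = "{a<..b}" and f = "\<lambda>t. norm (rect_integral f t b c d) - k * ((b - t) * (d - c))"])
       (use ab sub rect_boundD[OF W] in \<open>auto simp only: cl diff_le_0_iff_le atLeastAtMost_iff greaterThanAtMost_iff
          intro!: continuous_intros cont\<close>)
  then show ?thesis by simp
qed auto

lemma rect_bound_top:
  assumes f: "continuous_on (rect a b c d) f" and W: "rect_bound f k W" and ab: "a \<le> b" "c \<le> d"
    and sub: "\<And>t. c \<le> t \<Longrightarrow> t < d \<Longrightarrow> rect a b c t \<subseteq> W"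
  shows "norm (rect_integral f a b c d) \<le> k * ((b - a) * (d - c))"
proof (cases "c = d")
  case False
  then have cl: "closure {c..<d} = {c..d}" using ab by simp
  have "norm (rect_integral f a b c d) - k * ((b - a) * (d - c)) \<le> 0"
    by (rule continuous_le_on_closure[where S = "{c..<d}" and f = "\<lambda>t. norm (rect_integral f a b c t) - k * ((b - a) * (t - c))"])
       (use ab sub rect_boundD[OF W] in \<open>auto simp only: cl diff_le_0_iff_le atLeastAtMost_iff atLeastLessThan_iff
          intro!: continuous_intros continuous_on_rect_integral_Im[OF f]\<close>)
  then show ?thesis by simp
qed auto

lemma rect_bound_bottom:
  assumes f: "continuous_on (rect a b c d) f" and W: "rect_bound f k W" and ab: "a \<le> b" "c \<le> d"
    and sub: "\<And>t. c < t \<Longrightarrow> t \<le> d \<Longrightarrow> rect a b t d \<subseteq> W"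
  shows "norm (rect_integral f a b c d) \<le> k * ((b - a) * (d - c))"
proof (cases "c = d")
  case False
  then have cl: "closure {c<..d} = {c..d}" using ab by simp
  have "continuous_on {c..d} (\<lambda>t. rect_integral f a b c d - rect_integral f a b c t)"
    by (intro continuous_intros continuous_on_rect_integral_Im[OF f] ab)
  then have cont: "continuous_on {c..d} (\<lambda>t. rect_integral f a b t d)"
    by (rule continuous_on_eq) (use rect_integral_split_Im[OF f] ab in auto)
  have "norm (rect_integral f a b c d) - k * ((b - a) * (d - c)) \<le> 0"
    by (rule continuous_le_on_closure[where S = "{c<..d}" and f = "\<lambda>t. norm (rect_integral f a b t d) - k * ((b - a) * (d - t))"])
       (use ab sub rect_boundD[OF W] in \<open>auto simp only: cl diff_le_0_iff_le atLeastAtMost_iff greaterThanAtMost_iff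
          intro!: continuous_intros cont\<close>)
  then show ?thesis by simp
qed auto

text \<open>The inner rectangle is the bounding box of the compact part outside \<open>W\<close>.
  The four strips cut off meet this part at most along the side shared with the box, so the limit
  lemmas bound their integrals; their areas add up to the difference of the two areas.\<close>

lemma rect_touching_subrect:
  assumes W: "open W" and ab: "a \<le> b" "c \<le> d" and f: "continuous_on (rect a b c d) f"
    and bd: "rect_bound f k (rect a b c d \<inter> W)" and ne: "\<not> rect a b c d \<subseteq> W"
  obtains a1 b1 c1 d1 zl zr zb zt where
    "a \<le> a1" "a1 \<le> b1" "b1 \<le> b" "c \<le> c1" "c1 \<le> d1" "d1 \<le> d"
    "{zl, zr, zb, zt} \<subseteq> rect a1 b1 c1 d1 - W"
    "Re zl = a1" "Re zr = b1" "Im zb = c1" "Im zt = d1"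
    "norm (rect_integral f a b c d) \<le> norm (rect_integral f a1 b1 c1 d1)
       + k * ((b - a) * (d - c) - (b1 - a1) * (d1 - c1))"
proof -
  let ?K = "rect a b c d - W"
  have "compact ?K" "?K \<noteq> {}"
    using W ne by (auto intro: compact_diff)
  note att = continuous_attains_inf[OF this] continuous_attains_sup[OF this]
  obtain zl where zl: "zl \<in> ?K" "\<And>z. z \<in> ?K \<Longrightarrow> Re zl \<le> Re z"
    using att(1)[OF continuous_on_Re[OF continuous_on_id]] by blast
  obtain zr where zr: "zr \<in> ?K" "\<And>z. z \<in> ?K \<Longrightarrow> Re z \<le> Re zr"
    using att(2)[OF continuous_on_Re[OF continuous_on_id]] by blast
  obtain zb where zb: "zb \<in> ?K" "\<And>z. z \<in> ?K \<Longrightarrow> Im zb \<le> Im z"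
    using att(1)[OF continuous_on_Im[OF continuous_on_id]] by blast
  obtain zt where zt: "zt \<in> ?K" "\<And>z. z \<in> ?K \<Longrightarrow> Im z \<le> Im zt"
    using att(2)[OF continuous_on_Im[OF continuous_on_id]] by blast
  define a1 b1 c1 d1 where "a1 = Re zl" and "b1 = Re zr" and "c1 = Im zb" and "d1 = Im zt"
  note defs = a1_def b1_def c1_def d1_def
  have o: "a \<le> a1" "a1 \<le> b1" "b1 \<le> b" "c \<le> c1" "c1 \<le> d1" "d1 \<le> d"
    using zl zr zb zt by (auto simp: defs mem_rect)
  have K: "a1 \<le> Re z" "Re z \<le> b1" "c1 \<le> Im z" "Im z \<le> d1" if "z \<in> ?K" for z
    using zl(2) zr(2) zb(2) zt(2) that by (auto simp: defs)
  have cont: "continuous_on (rect a' b' c' d') f" if "a \<le> a'" "b' \<le> b" "c \<le> c'" "d' \<le> d" for a' b' c' d'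
    by (intro continuous_on_subset[OF f] rect_mono that)
  \<comment> \<open>The left and right strips have full height, the lower and upper ones only the
    width of the box.\<close>
  have 1: "norm (rect_integral f a a1 c d) \<le> k * ((a1 - a) * (d - c))"
    by (rule rect_bound_right[OF cont bd]) (use o ab K(1) in \<open>force simp: mem_rect\<close>)+
  have 2: "norm (rect_integral f b1 b c d) \<le> k * ((b - b1) * (d - c))"
    by (rule rect_bound_left[OF cont bd]) (use o ab K(2) in \<open>force simp: mem_rect\<close>)+
  have 3: "norm (rect_integral f a1 b1 c c1) \<le> k * ((b1 - a1) * (c1 - c))"
    by (rule rect_bound_top[OF cont bd]) (use o ab K(3) in \<open>force simp: mem_rect\<close>)+
  have 4: "norm (rect_integral f a1 b1 d1 d) \<le> k * ((b1 - a1) * (d - d1))"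
    by (rule rect_bound_bottom[OF cont bd]) (use o ab K(4) in \<open>force simp: mem_rect\<close>)+
  have "rect_integral f a b c d =
      rect_integral f a a1 c d + (rect_integral f a1 b1 c c1 + (rect_integral f a1 b1 c1 d1
      + rect_integral f a1 b1 d1 d) + rect_integral f b1 b c d)"
    using o ab
    by (simp add: rect_integral_split_Re[OF cont, of a b c d a1] rect_integral_split_Re[OF cont, of a1 b c d b1]
        rect_integral_split_Im[OF cont, of a1 b1 c d c1] rect_integral_split_Im[OF cont, of a1 b1 c1 d d1])
  also have "norm \<dots> \<le> k * ((a1 - a) * (d - c)) + (k * ((b1 - a1) * (c1 - c))
      + (norm (rect_integral f a1 b1 c1 d1) + k * ((b1 - a1) * (d - d1))) + k * ((b - b1) * (d - c)))"
    by (intro norm_triangle_mono 1 2 3 4 order_refl)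
  finally have "norm (rect_integral f a b c d) \<le> norm (rect_integral f a1 b1 c1 d1)
       + k * ((b - a) * (d - c) - (b1 - a1) * (d1 - c1))"
    by (simp add: algebra_simps)
  moreover have "{zl, zr, zb, zt} \<subseteq> rect a1 b1 c1 d1 - W"
    using zl(1) zr(1) zb(1) zt(1) K by (simp add: mem_rect)
  ultimately show ?thesis
    using that o by (auto simp: defs)
qed

text \<open>Halving a thin touching rectangle along its long side and shrinking both halves until they
  touch the exceptional set again reduces the error term, since the number of rectangles doubles
  while the squares of their diameters shrink by a factor four.\<close>

lemma rect_bound_extend:
  assumes f: "continuous_on B f" and W: "open W" and bd: "rect_bound f (80 * \<epsilon>) (B \<inter> W)"
    and q: "\<And>z w. z \<in> B - W \<Longrightarrow> w \<in> B \<Longrightarrow> Re w = Re z \<or> Im w = Im z \<Longrightarrow>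
               norm (f w - f z - (w - z) * q z) \<le> \<epsilon> * norm (w - z)"
    and "\<epsilon> \<ge> 0"
  shows "rect_bound f (80 * \<epsilon>) B"
proof -
  have cont: "continuous_on (rect a b c d) f" if "rect a b c d \<subseteq> B" for a b c d
    using f that continuous_on_subset by blast
  \<comment> \<open>\<open>L\<close> is any bound for the sides and \<open>n\<close> counts the
    remaining halvings; the error term tends to 0 with \<open>n\<close>, which leaves the pure area
    bound.\<close>
  have P: "norm (rect_integral f a b c d) \<le> 80 * \<epsilon> * ((b - a) * (d - c)) + 40 * \<epsilon> * L^2 / 2 ^ n"
    if "a \<le> b" "c \<le> d" "rect a b c d \<subseteq> B" "b - a \<le> L" "d - c \<le> L" for n a b c d L
    using that
  proof (induction n arbitrary: a b c d L)
    case (0 a b c d L)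
    show ?case
    proof (cases "rect a b c d \<subseteq> W")
      case True
      then have "norm (rect_integral f a b c d) \<le> 80 * \<epsilon> * ((b - a) * (d - c))"
        using rect_boundD[OF bd, of a b c d] 0 by simp
      then show ?thesis using \<open>\<epsilon> \<ge> 0\<close> by (simp add: add_increasing2)
    next
      case False
      obtain a1 b1 c1 d1 zl zr zb zt where *:
        "a \<le> a1" "a1 \<le> b1" "b1 \<le> b" "c \<le> c1" "c1 \<le> d1" "d1 \<le> d"
        "{zl, zr, zb, zt} \<subseteq> rect a1 b1 c1 d1 - W"
        "Re zl = a1" "Re zr = b1" "Im zb = c1" "Im zt = d1"
        "norm (rect_integral f a b c d) \<le> norm (rect_integral f a1 b1 c1 d1)
           + 80 * \<epsilon> * ((b - a) * (d - c) - (b1 - a1) * (d1 - c1))"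
        using rect_touching_subrect[OF W 0(1,2) cont[OF 0(3)] rect_bound_subset[OF bd] False] 0(3) by blast
      have sub: "rect a1 b1 c1 d1 \<subseteq> B" by (rule order.trans[OF rect_mono 0(3)]) (use * in auto)
      have "norm (rect_integral f a1 b1 c1 d1) \<le> 40 * \<epsilon> * L^2"
        by (rule rect_integral_touching_bound[OF cont[OF sub], where K = "rect a1 b1 c1 d1 - W"
              and q = q and zl = zl and zr = zr and zb = zb and zt = zt]; (rule q)?)
           (use * 0 sub \<open>\<epsilon> \<ge> 0\<close> in auto)
      moreover have "0 \<le> 80 * \<epsilon> * ((b1 - a1) * (d1 - c1))"
        using * \<open>\<epsilon> \<ge> 0\<close> by simp
      ultimately show ?thesis using *(12) by (simp add: algebra_simps)
    qed
  next
    case (Suc n a b c d L)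
    show ?case
    proof (cases "rect a b c d \<subseteq> W")
      case True
      then have "norm (rect_integral f a b c d) \<le> 80 * \<epsilon> * ((b - a) * (d - c))"
        using rect_boundD[OF bd, of a b c d] Suc.prems by simp
      then show ?thesis using \<open>\<epsilon> \<ge> 0\<close> by (simp add: add_increasing2)
    next
      case False
      obtain a1 b1 c1 d1 zl zr zb zt where *:
        "a \<le> a1" "a1 \<le> b1" "b1 \<le> b" "c \<le> c1" "c1 \<le> d1" "d1 \<le> d"
        "{zl, zr, zb, zt} \<subseteq> rect a1 b1 c1 d1 - W"
        "Re zl = a1" "Re zr = b1" "Im zb = c1" "Im zt = d1"
        "norm (rect_integral f a b c d) \<le> norm (rect_integral f a1 b1 c1 d1)
           + 80 * \<epsilon> * ((b - a) * (d - c) - (b1 - a1) * (d1 - c1))"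
        using rect_touching_subrect[OF W Suc.prems(1,2) cont[OF Suc.prems(3)] rect_bound_subset[OF bd] False]
          Suc.prems(3) by blast
      define w h where "w = b1 - a1" and "h = d1 - c1"
      have wh: "0 \<le> w" "0 \<le> h" "w \<le> L" "h \<le> L"
        using * Suc.prems by (auto simp: w_def h_def)
      have sub: "rect a1 b1 c1 d1 \<subseteq> B" by (rule order.trans[OF rect_mono Suc.prems(3)]) (use * in auto)
      have err: "0 \<le> 40 * \<epsilon> * L^2 / 2 ^ Suc n" using \<open>\<epsilon> \<ge> 0\<close> by simp
      \<comment> \<open>After halving the long side \<open>s\<close>, both pieces satisfy the
        induction hypothesis with s/2 in place of \<open>L\<close>, and 2 (s/2)^2 = s^2/2 supplies
        the extra factor 1/2.\<close>
      have halves: "2 * (80 * \<epsilon> * ((s / 2) * t) + 40 * \<epsilon> * (s / 2)^2 / 2 ^ n)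
             \<le> 80 * \<epsilon> * (s * t) + 40 * \<epsilon> * L^2 / 2 ^ Suc n" if "0 \<le> s" "s \<le> L" for s t
      proof -
        have "2 * (80 * \<epsilon> * ((s / 2) * t) + 40 * \<epsilon> * (s / 2)^2 / 2 ^ n)
            = 80 * \<epsilon> * (s * t) + 40 * \<epsilon> * s^2 / 2 ^ Suc n"
          by (simp add: power2_eq_square field_simps)
        moreover have "40 * \<epsilon> * s^2 / 2 ^ Suc n \<le> 40 * \<epsilon> * L^2 / 2 ^ Suc n"
          using that \<open>\<epsilon> \<ge> 0\<close> by (intro divide_right_mono mult_left_mono power_mono) auto
        ultimately show ?thesis by linarith
      qed
      have "norm (rect_integral f a1 b1 c1 d1) \<le> 80 * \<epsilon> * (w * h) + 40 * \<epsilon> * L^2 / 2 ^ Suc n"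
      proof -
        consider "w \<le> 2 * h" "h \<le> 2 * w" | "2 * h \<le> w" | "2 * w \<le> h" by linarith
        then show ?thesis
        proof cases
          \<comment> \<open>Here the squared longer side is at most twice the area, so the touching
            bound 40\<epsilon> (max w h)^2 is already absorbed by the area bound with constant
            80\<epsilon>.\<close>
          case 1
          have "norm (rect_integral f a1 b1 c1 d1) \<le> 40 * \<epsilon> * (max w h)^2"
            by (rule rect_integral_touching_bound[OF cont[OF sub], where K = "rect a1 b1 c1 d1 - W"
                  and q = q and zl = zl and zr = zr and zb = zb and zt = zt]; (rule q)?)
               (use * sub \<open>\<epsilon> \<ge> 0\<close> in \<open>auto simp: w_def h_def\<close>)
          also have "(max w h)^2 \<le> 2 * (w * h)"
          proof (cases "w \<le> h")
            case True
            then show ?thesis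
              using 1 wh mult_right_mono[of h "2 * w" h] by (simp add: max_def power2_eq_square)
          next
            case False
            then show ?thesis
              using 1 wh mult_left_mono[of w "2 * h" w] by (simp add: max_def power2_eq_square)
          qed
          finally have "norm (rect_integral f a1 b1 c1 d1) \<le> 80 * \<epsilon> * (w * h)"
            using \<open>\<epsilon> \<ge> 0\<close> by (simp add: mult_left_mono)
          then show ?thesis
            using err by linarith
        next
          \<comment> \<open>Since h is at most w/2, both sides of each half are bounded by
            w/2.\<close>
          case 2
          define t where "t = (a1 + b1) / 2"
          have t: "a1 \<le> t" "t \<le> b1" "t - a1 = w / 2" "b1 - t = w / 2"
            using * by (auto simp: t_def w_def field_simps)
          have "norm (rect_integral f a1 t c1 d1) \<le> 80 * \<epsilon> * ((t - a1) * (d1 - c1)) + 40 * \<epsilon> * (w / 2)^2 / 2 ^ n"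
            "norm (rect_integral f t b1 c1 d1) \<le> 80 * \<epsilon> * ((b1 - t) * (d1 - c1)) + 40 * \<epsilon> * (w / 2)^2 / 2 ^ n"
            by (rule Suc.IH; (rule order.trans[OF rect_mono sub])?; use * t 2 in \<open>simp add: h_def\<close>)+
          then have "norm (rect_integral f a1 b1 c1 d1) \<le> 2 * (80 * \<epsilon> * ((w / 2) * h) + 40 * \<epsilon> * (w / 2)^2 / 2 ^ n)"
            unfolding rect_integral_split_Re[OF cont[OF sub] t(1,2) *(5)] t h_def mult_2 by (rule norm_triangle_mono)
          then show ?thesis using halves[OF wh(1,3), of h] by linarith
        next
          case 3
          define t where "t = (c1 + d1) / 2"
          have t: "c1 \<le> t" "t \<le> d1" "t - c1 = h / 2" "d1 - t = h / 2"
            using * by (auto simp: t_def h_def field_simps)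
          have "norm (rect_integral f a1 b1 c1 t) \<le> 80 * \<epsilon> * ((b1 - a1) * (t - c1)) + 40 * \<epsilon> * (h / 2)^2 / 2 ^ n"
            "norm (rect_integral f a1 b1 t d1) \<le> 80 * \<epsilon> * ((b1 - a1) * (d1 - t)) + 40 * \<epsilon> * (h / 2)^2 / 2 ^ n"
            by (rule Suc.IH; (rule order.trans[OF rect_mono sub])?; use * t 3 in \<open>simp add: w_def\<close>)+
          then have "norm (rect_integral f a1 b1 c1 d1) \<le> 2 * (80 * \<epsilon> * ((h / 2) * w) + 40 * \<epsilon> * (h / 2)^2 / 2 ^ n)"
            unfolding rect_integral_split_Im[OF cont[OF sub] t(1,2) *(2)] t w_def mult.commute[of "b1 - a1"] mult_2 by (rule norm_triangle_mono)
          then show ?thesis using halves[OF wh(2,4), of w] unfolding mult.commute[of w h] by (rule order.trans)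
        qed
      qed
      then show ?thesis
        using *(12) by (simp add: w_def h_def algebra_simps)
    qed
  qed
  show ?thesis
    unfolding rect_bound_def
  proof (intro allI impI)
    fix a b c d assume *: "a \<le> b" "c \<le> d" "rect a b c d \<subseteq> B"
    define L where "L = max (b - a) (d - c)"
    have "(\<lambda>n. 80 * \<epsilon> * ((b - a) * (d - c)) + 40 * \<epsilon> * L^2 / 2 ^ n) \<longlonglongrightarrow> 80 * \<epsilon> * ((b - a) * (d - c)) + 0"
      by (intro tendsto_intros LIMSEQ_divide_realpow_zero) simp
    then show "norm (rect_integral f a b c d) \<le> 80 * \<epsilon> * ((b - a) * (d - c))"
      using P[OF *, of L] by (intro LIMSEQ_le_const) (auto simp: L_def)
  qed
qed

section \<open>The Looman-Menchoff theorem\<close>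

text \<open>Morera's argument: integrating along the bottom and then upwards, or along the left side
  and then across, gives the same primitive \<open>G\<close>. One description yields the
  y-derivative, the other the x-derivative. These partial derivatives are continuous and satisfy the
  Cauchy-Riemann equations, so \<open>f\<close> is locally the derivative of a holomorphic
  function.\<close>

lemma holomorphic_on_if_rect_integral_eq_0:
  assumes "open U" and f: "continuous_on U f"
    and zero: "\<And>a b c d. a \<le> b \<Longrightarrow> c \<le> d \<Longrightarrow> rect a b c d \<subseteq> U \<Longrightarrow> rect_integral f a b c d = 0"
  shows "f holomorphic_on U"
proof -
  have "\<exists>r>0. f holomorphic_on ball z0 r" if "z0 \<in> U" for z0
  proof -
    obtain A B where AB: "z0 \<in> box A B" "cbox A B \<subseteq> U"
      using open_contains_cbox[OF \<open>open U\<close> \<open>z0 \<in> U\<close>] by metis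
    define a b c d where "a = Re A" and "b = Re B" and "c = Im A" and "d = Im B"
    have U: "rect a b c d \<subseteq> U" using AB by (simp add: a_def b_def c_def d_def)
    have box: "z0 \<in> box (Complex a c) (Complex b d)" using AB by (simp add: a_def b_def c_def d_def)
    have ab: "a \<le> b" "c \<le> d" using box by (auto simp: in_box_complex_iff)
    define G where "G x y = integral {a..x} (\<lambda>t. f (Complex t c)) + \<i> * integral {c..y} (\<lambda>t. f (Complex x t))" for x y
    have G: "G x y = integral {a..x} (\<lambda>t. f (Complex t y)) + \<i> * integral {c..y} (\<lambda>t. f (Complex a t))"
      if "x \<in> {a..b}" "y \<in> {c..d}" for x y
    proof -
      have sub: "rect a x c y \<subseteq> U"
        by (rule order.trans[OF rect_mono U]) (use that in auto)
      note i = integrable_rect_horizontal[OF continuous_on_subset[OF f sub]]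
        integrable_rect_vertical[OF continuous_on_subset[OF f sub]]
      have "rect_integral f a x c y = 0"
        by (rule zero[OF _ _ sub]) (use that in auto)
      then show ?thesis
        unfolding rect_integral_def G_def
        using i that by (simp add: Henstock_Kurzweil_Integration.integral_diff algebra_simps)
    qed
    \<comment> \<open>The passage from partial to total derivatives needs one of them to be
      continuous as a map into bounded linear operators, hence this form of the
      y-derivative.\<close>
    define f' where "f' x y = blinfun_scaleR_left (\<i> * f (Complex x y))" for x y
    have dx: "((\<lambda>x. G x y) has_derivative (\<lambda>t. t *\<^sub>R f (Complex x y))) (at x within {a..b})"
      if "x \<in> {a..b}" "y \<in> {c..d}" for x y
    proof -
      have "continuous_on {a..b} (\<lambda>t. f (Complex t y))"
        by (intro continuous_on_compose2[OF f] continuous_intros)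
           (use U that in \<open>auto simp: mem_rect subset_iff\<close>)
      from integral_has_vector_derivative[OF this that(1)]
      have "((\<lambda>x. integral {a..x} (\<lambda>t. f (Complex t y)) + \<i> * integral {c..y} (\<lambda>t. f (Complex a t)))
          has_derivative (\<lambda>t. t *\<^sub>R f (Complex x y))) (at x within {a..b})"
        by (auto intro!: derivative_eq_intros simp: has_vector_derivative_def)
      then show ?thesis
        by (rule has_derivative_transform[OF that(1), rotated]) (use G that in auto)
    qed
    have dy: "((\<lambda>y. G x y) has_derivative blinfun_apply (f' x y)) (at y within {c..d})"
      if "x \<in> {a..b}" "y \<in> {c..d}" for x y
    proof -
      have "continuous_on {c..d} (\<lambda>t. f (Complex x t))"
        by (intro continuous_on_compose2[OF f] continuous_intros)
           (use U that in \<open>auto simp: mem_rect subset_iff\<close>)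
      from integral_has_vector_derivative[OF this that(2)]
      show ?thesis
        unfolding G_def f'_def
        by (auto intro!: derivative_eq_intros simp: has_vector_derivative_def algebra_simps)
    qed
    have hol: "((\<lambda>z. G (Re z) (Im z)) has_field_derivative f z) (at z)"
      if z: "z \<in> box (Complex a c) (Complex b d)" for z
    proof -
      have zr: "Re z \<in> {a..b}" "Im z \<in> {c..d}" using z by (auto simp: in_box_complex_iff)
      have "continuous_on ({a..b} \<times> {c..d}) (\<lambda>p. f' (fst p) (snd p))"
        unfolding f'_def
        by (intro continuous_intros continuous_on_compose2[OF f]
            bounded_linear.continuous_on[OF bounded_linear_blinfun_scaleR_left])
          (use U in \<open>auto simp: mem_rect subset_iff\<close>)
      then have within: "((\<lambda>(x, y). G x y) has_derivative (\<lambda>(tx, ty). tx *\<^sub>R f (Complex (Re z) (Im z)) + blinfun_apply (f' (Re z) (Im z)) ty))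
           (at (Re z, Im z) within {a..b} \<times> {c..d})"
        using zr
        by (intro has_derivative_partialsI dx dy)
           (auto simp: continuous_on_eq_continuous_within case_prod_unfold)
      have int: "(Re z, Im z) \<in> interior ({a..b} \<times> {c..d})"
        using z by (auto simp: interior_Times in_box_complex_iff)
      have *: "((\<lambda>(x, y). G x y) has_derivative (\<lambda>(tx, ty). tx *\<^sub>R f z + ty *\<^sub>R (\<i> * f z))) (at (Re z, Im z))"
        using within unfolding at_within_interior[OF int] f'_def by simp
      have "((\<lambda>w. (Re w, Im w)) has_derivative (\<lambda>w. (Re w, Im w))) (at z)"
        by (auto intro!: derivative_eq_intros)
      from has_derivative_compose[OF this *]
      have "((\<lambda>w. G (Re w) (Im w)) has_derivative (\<lambda>w. Re w *\<^sub>R f z + Im w *\<^sub>R (\<i> * f z))) (at z)"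
        by simp
      moreover have "(\<lambda>w. Re w *\<^sub>R f z + Im w *\<^sub>R (\<i> * f z)) = (*) (f z)"
        by (auto simp: fun_eq_iff complex_eq_iff algebra_simps)
      ultimately show ?thesis by (simp add: has_field_derivative_def)
    qed
    have "(\<lambda>z. G (Re z) (Im z)) holomorphic_on box (Complex a c) (Complex b d)"
      unfolding holomorphic_on_open[OF open_box] using hol by blast
    then have "deriv (\<lambda>z. G (Re z) (Im z)) holomorphic_on box (Complex a c) (Complex b d)"
      by (rule holomorphic_deriv) auto
    then have "f holomorphic_on box (Complex a c) (Complex b d)"
      by (rule holomorphic_transform) (use hol DERIV_imp_deriv in auto)
    moreover obtain r where "r > 0" "ball z0 r \<subseteq> box (Complex a c) (Complex b d)"
      by (rule openE[OF open_box box])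
    ultimately show ?thesis
      using holomorphic_on_subset by blast
  qed
  then show ?thesis
    unfolding holomorphic_on_open[OF \<open>open U\<close>] by (meson centre_in_ball holomorphic_on_open open_ball)
qed

lemma unit_on_axis:
  fixes v :: complex
  assumes "v \<noteq> 0" "Re v = 0 \<or> Im v = 0"
  shows "v /\<^sub>R norm v \<in> {1, -1, \<i>, -\<i>}"
  using assms(2)
proof
  assume "Re v = 0"
  moreover from this have "Im v \<noteq> 0" using assms(1) by (auto simp: complex_eq_iff)
  ultimately show ?thesis
    by (cases "Im v > 0") (auto simp: complex_eq_iff cmod_eq_Im field_simps)
next
  assume "Im v = 0"
  moreover from this have "Re v \<noteq> 0" using assms(1) by (auto simp: complex_eq_iff)
  ultimately show ?thesis
    by (cases "Re v > 0") (auto simp: complex_eq_iff cmod_eq_Re field_simps)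
qed

text \<open>One-sided limits in the four axis directions with a common \<open>D\<close> amount to
  both partial derivatives together with the Cauchy-Riemann equations at a single point.\<close>

theorem Looman_Menchoff:
  fixes f :: "complex \<Rightarrow> complex"
  assumes U: "open U" and f: "continuous_on U f"
    and der: "\<And>z. z \<in> U \<Longrightarrow> \<exists>D. \<forall>h\<in>{1, -1, \<i>, -\<i>}.
                ((\<lambda>t::real. (f (z + t *\<^sub>R h) - f z) /\<^sub>R t) \<longlongrightarrow> h * D) (at_right 0)"
  shows "f holomorphic_on U"
proof -
  let ?H = "{1, -1, \<i>, -\<i>} :: complex set"
  have bound: "rect_bound f (80 * \<epsilon>) U" if "\<epsilon> > 0" for \<epsilon>
  proof -
    define W where "W = {z. \<exists>r>0. ball z r \<subseteq> U \<and> rect_bound f (80 * \<epsilon>) (ball z r)}"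
    have "open W"
      unfolding open_contains_ball
    proof
      fix z assume "z \<in> W"
      then obtain r where r: "r > 0" "ball z r \<subseteq> U" "rect_bound f (80 * \<epsilon>) (ball z r)"
        by (auto simp: W_def)
      have "w \<in> W" if w: "w \<in> ball z r" for w
      proof -
        obtain s where "s > 0" "ball w s \<subseteq> ball z r"
          by (rule openE[OF open_ball w])
        moreover from this have "rect_bound f (80 * \<epsilon>) (ball w s)"
          by (intro rect_bound_subset[OF r(3)])
        ultimately show ?thesis
          using r(2) by (auto simp: W_def)
      qed
      then show "\<exists>e>0. ball z e \<subseteq> W" using r by blast
    qed
    have loc: "rect_bound f (80 * \<epsilon>) V" if "V \<subseteq> W" "V \<subseteq> U" for V
      using that by (intro rect_bound_local continuous_on_subset[OF f]) (auto simp: W_def)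
    have "U \<subseteq> W"
    proof (rule ccontr)
      assume "\<not> U \<subseteq> W"
      then obtain z0 where z0: "z0 \<in> U" "z0 \<notin> W" by blast
      obtain r0 where "r0 > 0" "ball z0 r0 \<subseteq> U"
        by (rule openE[OF U z0(1)])
      \<comment> \<open>Half the radius leaves room: points of \<open>F\<close> lie within
        \<open>r\<close> of \<open>z0\<close>, and shifting them by at most \<open>r\<close> stays
        in \<open>U\<close>.\<close>
      define r where "r = r0 / 2"
      have r: "r > 0" and rU: "ball z0 (2 * r) \<subseteq> U"
        using \<open>r0 > 0\<close> \<open>ball z0 r0 \<subseteq> U\<close> by (auto simp: r_def)
      define F where "F = ball z0 r - W"
      have shift: "z + t *\<^sub>R h \<in> U" if "z \<in> F" "0 \<le> t" "t \<le> r" "h \<in> ?H" for z t h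
      proof -
        have "norm (t *\<^sub>R h) \<le> r" using that by auto
        then have "z + t *\<^sub>R h \<in> ball z0 (2 * r)"
          using that(1) norm_triangle_ineq4[of "z0 - z" "t *\<^sub>R h"] by (auto simp: F_def dist_norm algebra_simps)
        then show ?thesis using rU by blast
      qed
      have FU: "F \<subseteq> U" using shift[of _ 0 1] r by auto
      define \<delta> where "\<delta> n = r / Suc n" for n :: nat
      have \<delta>: "0 < \<delta> n" "\<delta> n \<le> r" for n
        using r by (auto simp: \<delta>_def field_simps)
      \<comment> \<open>The derivative \<open>D\<close> need not depend continuously on the point.
        The difference quotient at the fixed scale \<open>\<delta> n\<close> does, and replaces it
        as slope; this makes the sets \<open>S n\<close> relatively closed.\<close>
      define q where "q n z = (f (z + \<delta> n *\<^sub>R 1) - f z) /\<^sub>R \<delta> n" for n z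
      define S where "S n = (\<Inter>(h, t)\<in>?H \<times> {0<..\<delta> n}.
          F \<inter> (\<lambda>z. norm (f (z + t *\<^sub>R h) - f z - (t *\<^sub>R h) * q n z)) -` {..\<epsilon> * t})" for n
      have closed: "closedin (top_of_set F) (S n)" for n
        unfolding S_def
      proof (intro closedin_INT)
        fix p assume p: "p \<in> ?H \<times> {0<..\<delta> n}"
        obtain h t where ht: "p = (h, t)" "h \<in> ?H" "0 < t" "t \<le> \<delta> n" using p by auto
        have s1: "z + t *\<^sub>R h \<in> U" if "z \<in> F" for z
          by (rule shift[OF that _ _ ht(2)]) (use ht \<delta>[of n] in auto)
        have s2: "z + \<delta> n *\<^sub>R 1 \<in> U" if "z \<in> F" for z
          by (rule shift[OF that]) (use \<delta>[of n] in auto)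
        have "continuous_on F (\<lambda>z. norm (f (z + t *\<^sub>R h) - f z - (t *\<^sub>R h) * q n z))"
          unfolding q_def
          by (intro continuous_intros continuous_on_compose2[OF f])
             (use s1 s2 FU in blast)+
        then show "closedin (top_of_set F) (case p of (h, t) \<Rightarrow>
            F \<inter> (\<lambda>z. norm (f (z + t *\<^sub>R h) - f z - (t *\<^sub>R h) * q n z)) -` {..\<epsilon> * t})"
          unfolding ht by (auto intro: continuous_closedin_preimage)
      qed (use \<delta> in auto)
      have "z \<in> (\<Union>n. S n)" if "z \<in> F" for z
      proof -
        obtain D where D: "\<And>h. h \<in> ?H \<Longrightarrow> ((\<lambda>t::real. (f (z + t *\<^sub>R h) - f z) /\<^sub>R t) \<longlongrightarrow> h * D) (at_right 0)"
          using der \<open>z \<in> F\<close> FU by blast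
        \<comment> \<open>Half of \<epsilon> pays for replacing increments by \<open>D\<close>, the
          other half for replacing \<open>D\<close> by \<open>q n z\<close>.\<close>
        have "\<forall>\<^sub>F t in at_right 0. \<forall>h\<in>?H. dist ((f (z + t *\<^sub>R h) - f z) /\<^sub>R t) (h * D) < \<epsilon> / 2"
          using D \<open>\<epsilon> > 0\<close> by (intro eventually_ball_finite ballI tendstoD) auto
        then obtain e where e: "e > 0" "\<And>t h. 0 < t \<Longrightarrow> t < e \<Longrightarrow> h \<in> ?H \<Longrightarrow> dist ((f (z + t *\<^sub>R h) - f z) /\<^sub>R t) (h * D) < \<epsilon> / 2"
          unfolding eventually_at_right_field by blast
        obtain n where n: "\<delta> n < e"
        proof -
          obtain n where "r / e < real n" using reals_Archimedean2 by blast
          then have "\<delta> n < e" using e r by (simp add: \<delta>_def field_simps)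
          then show ?thesis using that by blast
        qed
        have diff: "norm (f (z + t *\<^sub>R h) - f z - (t *\<^sub>R h) * D) \<le> \<epsilon> / 2 * t" if "0 < t" "t \<le> \<delta> n" "h \<in> ?H" for t h
        proof -
          have "f (z + t *\<^sub>R h) - f z - (t *\<^sub>R h) * D = t *\<^sub>R ((f (z + t *\<^sub>R h) - f z) /\<^sub>R t - h * D)"
            using that by (simp add: scaleR_diff_right)
          also have "norm \<dots> \<le> t * (\<epsilon> / 2)"
            using e(2)[of t h] that n by (simp add: dist_norm)
          finally show ?thesis by (simp add: mult.commute)
        qed
        have "norm (q n z - D) < \<epsilon> / 2"
          using e(2)[of "\<delta> n" 1] \<delta>[of n] n by (simp add: q_def dist_norm)
        then have "norm (f (z + t *\<^sub>R h) - f z - (t *\<^sub>R h) * q n z) \<le> \<epsilon> * t" if "0 < t" "t \<le> \<delta> n" "h \<in> ?H" for t h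
        proof -
          assume qD: "norm (q n z - D) < \<epsilon> / 2"
          have "f (z + t *\<^sub>R h) - f z - (t *\<^sub>R h) * q n z
              = (f (z + t *\<^sub>R h) - f z - (t *\<^sub>R h) * D) - (t *\<^sub>R h) * (q n z - D)"
            by (simp add: algebra_simps)
          also have "norm \<dots> \<le> \<epsilon> / 2 * t + t * (\<epsilon> / 2)"
            using qD that
            by (intro order.trans[OF norm_triangle_ineq4] add_mono diff) (auto simp: norm_mult)
          finally show ?thesis by (simp add: field_simps)
        qed
        then have "z \<in> S n" using \<open>z \<in> F\<close> by (auto simp: S_def)
        then show ?thesis by blast
      qed
      then have Un: "(\<Union>n. S n) = F"
        using closedin_subset[OF closed] by auto
      \<comment> \<open>\<open>F\<close> is closed in an open ball and therefore completely
        metrizable, so Baire applies although \<open>F\<close> need not be closed in the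
        plane.\<close>
      have cm: "completely_metrizable_space (top_of_set F)"
      proof -
        have "completely_metrizable_space (top_of_set (ball z0 r))"
          by (intro completely_metrizable_space_openin completely_metrizable_space_euclidean) auto
        moreover have "closedin (top_of_set (ball z0 r)) F"
          using \<open>open W\<close> unfolding F_def by (simp add: Diff_eq closedin_closed_Int closed_Compl)
        ultimately show ?thesis
          using completely_metrizable_space_closedin[of "top_of_set (ball z0 r)" F]
            closedin_subset[of "top_of_set (ball z0 r)" F]
          by (simp add: subtopology_subtopology inf.absorb2)
      qed
      have "\<exists>n. top_of_set F interior_of S n \<noteq> {}"
      proof (rule ccontr)
        assume "\<nexists>n. top_of_set F interior_of S n \<noteq> {}"
        then have "top_of_set F interior_of (\<Union>(range S)) = {}"
          using cm closed by (intro Baire_category_alt) auto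
        moreover have "z0 \<in> F" using z0 r by (auto simp: F_def)
        ultimately show False
          unfolding Un by (metis empty_iff interior_of_topspace topspace_euclidean_subtopology)
      qed
      then obtain n z1 T where T: "openin (top_of_set F) T" "z1 \<in> T" "T \<subseteq> S n"
        by (auto simp: interior_of_def)
      then obtain O' where O: "open O'" "T = F \<inter> O'" by (auto simp: openin_open)
      then have O0: "open (O' \<inter> ball z0 r)" "z1 \<in> O' \<inter> ball z0 r"
        using T by (auto simp: F_def)
      obtain \<rho>0 where \<rho>0: "\<rho>0 > 0" "ball z1 \<rho>0 \<subseteq> O' \<inter> ball z0 r"
        by (rule openE[OF O0])
      \<comment> \<open>Two points of this ball are at distance below \<open>\<delta> n\<close>, so
        the defining estimates of \<open>S n\<close> cover all axis increments inside it. The area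
        bound then extends to the whole ball, contradicting that \<open>z1\<close> lies outside
        \<open>W\<close>.\<close>
      define \<rho> where "\<rho> = min \<rho>0 (\<delta> n / 2)"
      have \<rho>: "\<rho> > 0" "ball z1 \<rho> \<subseteq> O' \<inter> ball z0 r" "2 * \<rho> \<le> \<delta> n"
        using \<rho>0 \<delta>[of n] by (auto simp: \<rho>_def)
      have BU: "ball z1 \<rho> \<subseteq> U" using \<rho> rU r by (auto simp: subset_iff)
      have "rect_bound f (80 * \<epsilon>) (ball z1 \<rho>)"
      proof (rule rect_bound_extend[where W = W and q = "q n"])
        show "continuous_on (ball z1 \<rho>) f" using f BU continuous_on_subset by blast
        show "rect_bound f (80 * \<epsilon>) (ball z1 \<rho> \<inter> W)" using BU by (intro loc) auto
        fix z w assume z: "z \<in> ball z1 \<rho> - W" and w: "w \<in> ball z1 \<rho>" "Re w = Re z \<or> Im w = Im z"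
        show "norm (f w - f z - (w - z) * q n z) \<le> \<epsilon> * norm (w - z)"
        proof (cases "w = z")
          case False
          define t where "t = norm (w - z)"
          have t: "0 < t" "t \<le> \<delta> n"
            using False z w dist_triangle2[of w z z1] \<rho>(3) by (auto simp: t_def dist_norm norm_minus_commute)
          define h where "h = (w - z) /\<^sub>R t"
          have w': "w = z + t *\<^sub>R h" using t by (simp add: h_def)
          have "h \<in> ?H"
            unfolding h_def t_def by (rule unit_on_axis) (use w(2) False in auto)
          moreover have "z \<in> S n"
          proof -
            have "z \<in> O' \<inter> ball z0 r" using z \<rho>(2) by blast
            then have "z \<in> T" using z O(2) by (auto simp: F_def)
            then show ?thesis using T(3) by blast
          qed
          ultimately show ?thesis
            using t unfolding t_def[symmetric] by (auto simp: S_def w')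
        qed simp
      qed (use \<open>open W\<close> \<open>\<epsilon> > 0\<close> in auto)
      then have "z1 \<in> W" using \<rho>(1) BU by (auto simp: W_def)
      then show False using T O by (auto simp: F_def)
    qed
    then show ?thesis by (intro loc) auto
  qed
  show ?thesis
  proof (rule holomorphic_on_if_rect_integral_eq_0[OF U f])
    fix a b c d assume *: "a \<le> b" "c \<le> d" "rect a b c d \<subseteq> U"
    define A where "A = (b - a) * (d - c)"
    have A: "A \<ge> 0" using * by (simp add: A_def)
    have "norm (rect_integral f a b c d) \<le> 0 + e" if "e > 0" for e
    proof -
      \<comment> \<open>The denominator has A + 1 because the area of a degenerate rectangle is
        0.\<close>
      have "norm (rect_integral f a b c d) \<le> 80 * (e / (80 * (A + 1))) * A"
        unfolding A_def[symmetric] using rect_boundD[OF bound *, of "e / (80 * (A + 1))"] A \<open>e > 0\<close>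
        by (simp add: A_def)
      also have "\<dots> \<le> e" using A \<open>e > 0\<close> by (simp add: field_simps)
      finally show ?thesis by simp
    qed
    then have "norm (rect_integral f a b c d) \<le> 0" by (rule field_le_epsilon)
    then show "rect_integral f a b c d = 0" by simp
  qed
qed

section \<open>Directional derivatives along a linear map\<close>

lemma has_vector_derivative_at_0_iff:
  "(f has_vector_derivative D) (at 0) \<longleftrightarrow> ((\<lambda>t. (f t - f 0) /\<^sub>R t) \<longlongrightarrow> D) (at 0)"
proof -
  have "((\<lambda>t. norm (f t - f 0 - t *\<^sub>R D) / norm t) \<longlongrightarrow> 0) (at 0) \<longleftrightarrow>
        ((\<lambda>t. norm ((f t - f 0) /\<^sub>R t - D)) \<longlongrightarrow> 0) (at 0)"
  proof (rule filterlim_cong)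
    show "\<forall>\<^sub>F t in at 0. norm (f t - f 0 - t *\<^sub>R D) / norm t = norm ((f t - f 0) /\<^sub>R t - D)"
      unfolding eventually_at_filter
    proof (intro always_eventually allI impI)
      fix t :: real assume "t \<noteq> 0"
      then have "(f t - f 0) /\<^sub>R t - D = (f t - f 0 - t *\<^sub>R D) /\<^sub>R t"
        by (simp add: scaleR_diff_right)
      then show "norm (f t - f 0 - t *\<^sub>R D) / norm t = norm ((f t - f 0) /\<^sub>R t - D)"
        by (simp add: divide_inverse mult.commute)
    qed
  qed auto
  then show ?thesis
    unfolding has_vector_derivative_def has_derivative_at tendsto_norm_zero_iff
    by (simp add: bounded_linear_scaleR_left tendsto_norm_zero_iff flip: LIM_zero_iff[of _ D])
qed

text \<open>The scalar trace of monogenicity: \<open>l\<close> will be f_u read in real coordinates.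
  The limits are one-sided and nothing is assumed about how \<open>d\<close> varies with the
  point.\<close>

definition dir_diff :: "('v::real_vector \<Rightarrow> complex) \<Rightarrow> 'v set \<Rightarrow> ('v \<Rightarrow> complex) \<Rightarrow> bool" where
  "dir_diff l P g \<longleftrightarrow> (\<forall>p\<in>P. \<exists>d. \<forall>h. ((\<lambda>t::real. (g (p + t *\<^sub>R h) - g p) /\<^sub>R t) \<longlongrightarrow> l h * d) (at_right 0))"

lemma dir_diff_subset: "dir_diff l P g \<Longrightarrow> Q \<subseteq> P \<Longrightarrow> dir_diff l Q g"
  by (auto simp: dir_diff_def)

lemma dir_diff_diff:
  assumes "dir_diff l P f" "dir_diff l P g"
  shows "dir_diff l P (\<lambda>p. f p - g p)"
  unfolding dir_diff_def
proof
  fix p assume "p \<in> P"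
  then obtain d e where
    "\<And>h. ((\<lambda>t::real. (f (p + t *\<^sub>R h) - f p) /\<^sub>R t) \<longlongrightarrow> l h * d) (at_right 0)"
    "\<And>h. ((\<lambda>t::real. (g (p + t *\<^sub>R h) - g p) /\<^sub>R t) \<longlongrightarrow> l h * e) (at_right 0)"
    using assms unfolding dir_diff_def by blast
  from tendsto_diff[OF this]
  have "((\<lambda>t::real. (f (p + t *\<^sub>R h) - g (p + t *\<^sub>R h) - (f p - g p)) /\<^sub>R t) \<longlongrightarrow> l h * (d - e)) (at_right 0)" for h
    by (simp add: algebra_simps)
  then show "\<exists>d. \<forall>h. ((\<lambda>t::real. (f (p + t *\<^sub>R h) - g (p + t *\<^sub>R h) - (f p - g p)) /\<^sub>R t) \<longlongrightarrow> l h * d) (at_right 0)"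
    by blast
qed

lemma has_vector_derivative_compose_holomorphic:
  assumes "G holomorphic_on D" "open D" "w \<in> D"
  shows "((\<lambda>t::real. G (w + t *\<^sub>R k)) has_vector_derivative k * deriv G w) (at 0)"
proof -
  have "(G has_field_derivative deriv G w) (at (w + 0 *\<^sub>R k))"
    using assms holomorphic_derivI by auto
  then show ?thesis
    by (intro field_vector_diff_chain_at[where f = "\<lambda>t. w + t *\<^sub>R k" and g = G, unfolded o_def])
       (auto intro!: derivative_eq_intros)
qed

lemma tendsto_compose_holomorphic:
  assumes "G holomorphic_on D" "open D" "w \<in> D"
  shows "((\<lambda>t::real. (G (w + t *\<^sub>R k) - G w) /\<^sub>R t) \<longlongrightarrow> k * deriv G w) (at_right 0)"
  using has_vector_derivative_compose_holomorphic[OF assms, of k]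
  unfolding has_vector_derivative_at_0_iff by (simp add: filterlim_at_split)

lemma dir_diff_holomorphic:
  assumes l: "linear l" and G: "G holomorphic_on D" "open D" and "l ` P \<subseteq> D"
  shows "dir_diff l P (\<lambda>p. G (l p))"
  unfolding dir_diff_def linear_add[OF l] linear_scale[OF l]
  using tendsto_compose_holomorphic[OF G] assms(4) by blast

text \<open>The direction and its negative both lie in the kernel of \<open>l\<close>. Their
  one-sided limits give vanishing right and left derivatives, hence an ordinary zero derivative
  along the segment.\<close>

lemma dir_diff_constant_on_segment:
  fixes g :: "'v::euclidean_space \<Rightarrow> complex"
  assumes l: "linear l" and g: "dir_diff l P g" and sub: "closed_segment p q \<subseteq> P" and "l (q - p) = 0"
  shows "g p = g q"
proof -
  define \<phi> where "\<phi> t = g (p + t *\<^sub>R (q - p))" for t :: real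
  have "(\<phi> has_vector_derivative 0) (at t)" if "t \<in> {0..1}" for t
  proof -
    have "p + t *\<^sub>R (q - p) = (1 - t) *\<^sub>R p + t *\<^sub>R q"
      by (simp add: algebra_simps)
    moreover have "(1 - t) *\<^sub>R p + t *\<^sub>R q \<in> closed_segment p q"
      using that by (auto simp: in_segment)
    ultimately have x: "p + t *\<^sub>R (q - p) \<in> P"
      using sub by auto
    have r: "((\<lambda>s. (\<phi> (t + s) - \<phi> t) /\<^sub>R s) \<longlongrightarrow> 0) (at_right 0)"
      and l: "((\<lambda>s. (\<phi> (t - s) - \<phi> t) /\<^sub>R s) \<longlongrightarrow> 0) (at_right 0)"
    proof -
      obtain d where d: "\<And>h. ((\<lambda>s::real. (g (p + t *\<^sub>R (q - p) + s *\<^sub>R h) - g (p + t *\<^sub>R (q - p))) /\<^sub>R s) \<longlongrightarrow> l h * d) (at_right 0)"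
        using g x unfolding dir_diff_def by blast
      show "((\<lambda>s. (\<phi> (t + s) - \<phi> t) /\<^sub>R s) \<longlongrightarrow> 0) (at_right 0)"
        using d[of "q - p"] \<open>l (q - p) = 0\<close> by (simp add: \<phi>_def scaleR_add_left add.assoc)
      show "((\<lambda>s. (\<phi> (t - s) - \<phi> t) /\<^sub>R s) \<longlongrightarrow> 0) (at_right 0)"
        using d[of "- (q - p)"] \<open>l (q - p) = 0\<close> unfolding linear_neg[OF l] scaleR_minus_right
        by (simp add: \<phi>_def scaleR_diff_left algebra_simps)
    qed
    have "((\<lambda>s. - ((\<phi> (t - s) - \<phi> t) /\<^sub>R s)) \<longlongrightarrow> - 0) (at_right 0)"
      by (intro tendsto_minus l)
    then have "((\<lambda>s. (\<phi> (t + s) - \<phi> t) /\<^sub>R s) \<longlongrightarrow> 0) (at_left 0)"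
      by (subst filterlim_at_left_to_right) simp
    with r have "((\<lambda>s. (\<phi> (t + s) - \<phi> (t + 0)) /\<^sub>R s) \<longlongrightarrow> 0) (at 0)"
      by (simp add: filterlim_at_split)
    then have "((\<lambda>s. \<phi> (t + s)) has_vector_derivative 0) (at 0)"
      unfolding has_vector_derivative_at_0_iff .
    then have "((\<lambda>s. \<phi> (t + s)) has_derivative (\<lambda>x. 0)) (at (t - t))"
      by (simp add: has_vector_derivative_def)
    then have "((\<lambda>s. \<phi> (t + (s - t))) has_derivative (\<lambda>x. 0)) (at t)"
      by (intro has_derivative_compose[where f = "\<lambda>s. s - t" and g = "\<lambda>s. \<phi> (t + s)" and g' = "\<lambda>x. 0"])
         (auto intro!: derivative_eq_intros)
    then show ?thesis by (simp add: has_vector_derivative_def)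
  qed
  then obtain c where c: "\<And>t. t \<in> {0..1} \<Longrightarrow> \<phi> t = c"
    using has_vector_derivative_zero_constant[of "{0..1}" \<phi>] has_vector_derivative_at_within
    by (metis convex_closed_interval)
  have "\<phi> 0 = \<phi> 1" using c[of 0] c[of 1] by simp
  then show ?thesis by (simp add: \<phi>_def)
qed

text \<open>Directional convexity makes \<open>g\<close> constant on the fibres of \<open>l\<close>,
  so \<open>G\<close> may be computed with any choice of preimage. Near a given point the preimage
  is taken on an affine section of \<open>l\<close>, which carries continuity and the directional
  limits of \<open>g\<close> over to \<open>G\<close>.\<close>

lemma dir_diff_factors:
  fixes g :: "'v::euclidean_space \<Rightarrow> complex"
  assumes l: "linear l" "surj l" and P: "open P" "convex_in_direction {h. l h = 0} P"
    and g: "dir_diff l P g" "continuous_on P g"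
  obtains G where "G holomorphic_on l ` P" "\<And>p. p \<in> P \<Longrightarrow> g p = G (l p)"
proof -
  define G where "G w = g (SOME p. p \<in> P \<and> l p = w)" for w
  have G: "g p = G (l p)" if "p \<in> P" for p
  proof -
    define q where "q = (SOME q. q \<in> P \<and> l q = l p)"
    have q: "q \<in> P" "l q = l p"
      using someI[of "\<lambda>q. q \<in> P \<and> l q = l p" p] that by (auto simp: q_def)
    then have "closed_segment p q \<subseteq> P"
      using P(2) that by (auto simp: convex_in_direction_def linear_diff[OF l(1)])
    then have "g p = g q"
      by (rule dir_diff_constant_on_segment[OF l(1) g(1)]) (simp add: q linear_diff[OF l(1)])
    then show ?thesis by (simp add: G_def q_def)
  qed
  obtain \<sigma> where \<sigma>: "linear \<sigma>" "l \<circ> \<sigma> = id"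
    using linear_surjective_right_inverse[OF l] by blast
  have l\<sigma>: "l (\<sigma> w) = w" for w using \<sigma>(2) by (metis comp_apply id_apply)
  have \<sigma>c: "continuous_on A \<sigma>" for A
    using \<sigma>(1) by (simp add: linear_continuous_on linear_linear)
  \<comment> \<open>The values w for which the section through \<open>p\<close> still lands in
    \<open>P\<close>.\<close>
  define N where "N p = (\<lambda>w. p + \<sigma> (w - l p)) -` P" for p
  have N: "open (N p)" for p
    unfolding N_def by (intro open_vimage P continuous_intros continuous_on_compose2[OF \<sigma>c]) auto
  have Np: "l p \<in> N p" if "p \<in> P" for p
    using that linear_0[OF \<sigma>(1)] by (simp add: N_def)
  have GN: "G w = g (p + \<sigma> (w - l p))" if "w \<in> N p" for w p
    using G[of "p + \<sigma> (w - l p)"] that by (simp add: N_def linear_add[OF l(1)] l\<sigma>)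
  have "G holomorphic_on l ` P"
  proof (rule Looman_Menchoff)
    show "open (l ` P)" using open_surjective_linear_image[OF P(1) l] .
    show "continuous_on (l ` P) G"
    proof (rule continuous_at_imp_continuous_on, safe)
      fix p assume "p \<in> P"
      have "continuous_on (N p) (\<lambda>w. g (p + \<sigma> (w - l p)))"
        by (intro continuous_on_compose2[OF g(2)] continuous_intros continuous_on_compose2[OF \<sigma>c])
           (auto simp: N_def)
      then have "continuous_on (N p) G"
        by (rule continuous_on_eq) (simp add: GN)
      then show "isCont G (l p)"
        using N Np \<open>p \<in> P\<close> continuous_on_eq_continuous_at by blast
    qed
    show "\<exists>D. \<forall>h\<in>{1, -1, \<i>, -\<i>}. ((\<lambda>t::real. (G (w + t *\<^sub>R h) - G w) /\<^sub>R t) \<longlongrightarrow> h * D) (at_right 0)"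
      if w: "w \<in> l ` P" for w
    proof -
      obtain p where p: "p \<in> P" "w = l p" using w by blast
      obtain d where d: "\<And>h. ((\<lambda>t::real. (g (p + t *\<^sub>R h) - g p) /\<^sub>R t) \<longlongrightarrow> l h * d) (at_right 0)"
        using g p unfolding dir_diff_def by blast
      have "((\<lambda>t::real. (G (w + t *\<^sub>R h) - G w) /\<^sub>R t) \<longlongrightarrow> h * d) (at_right 0)" for h
      proof -
        have "((\<lambda>t. w + t *\<^sub>R h) \<longlongrightarrow> w + 0 *\<^sub>R h) (at_right 0)"
          by (intro tendsto_intros)
        then have "\<forall>\<^sub>F t in at_right 0. w + t *\<^sub>R h \<in> N p"
          using N[of p] Np p by (simp add: topological_tendstoD)
        then have "\<forall>\<^sub>F t in at_right 0. (g (p + t *\<^sub>R \<sigma> h) - g p) /\<^sub>R t = (G (w + t *\<^sub>R h) - G w) /\<^sub>R t"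
          by eventually_elim (simp add: GN p G[symmetric] linear_scale[OF \<sigma>(1)])
        with d[of "\<sigma> h"] show ?thesis
          unfolding l\<sigma> by (rule Lim_transform_eventually)
      qed
      then show ?thesis by blast
    qed
  qed
  then show ?thesis using that G by blast
qed

text \<open>An identity theorem without directional convexity of \<open>P\<close>. Balls are convex,
  so near a limit point of the interior of the zero set \<open>g\<close> factors through a
  holomorphic function that vanishes on a nonempty open set; hence this interior is closed in
  \<open>P\<close>.\<close>

lemma dir_diff_eq_0:
  fixes g :: "'v::euclidean_space \<Rightarrow> complex"
  assumes l: "linear l" "surj l" and P: "open P" "connected P"
    and g: "dir_diff l P g" "continuous_on P g"
    and V: "open V" "V \<noteq> {}" "V \<subseteq> P" "\<And>p. p \<in> V \<Longrightarrow> g p = 0" and "p \<in> P"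
  shows "g p = 0"
proof -
  define Z where "Z = interior {p \<in> P. g p = 0}"
  have Z: "open Z" "Z \<subseteq> P" "\<And>p. p \<in> Z \<Longrightarrow> g p = 0"
    using interior_subset[of "{p \<in> P. g p = 0}"] by (auto simp: Z_def)
  have "V \<subseteq> Z" unfolding Z_def using V by (intro interior_maximal) auto
  have cl: "q \<in> Z" if q: "q \<in> P" "q \<in> closure Z" for q
  proof -
    obtain r where r: "r > 0" "ball q r \<subseteq> P" by (rule openE[OF P(1) q(1)])
    have "convex_in_direction {h. l h = 0} (ball q r)"
      unfolding convex_in_direction_def using convex_ball convex_contains_segment by blast
    then obtain G where G: "G holomorphic_on l ` ball q r" "\<And>p. p \<in> ball q r \<Longrightarrow> g p = G (l p)"
      using dir_diff_factors[OF l open_ball _ dir_diff_subset[OF g(1) r(2)] continuous_on_subset[OF g(2) r(2)]]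
      by blast
    have "Z \<inter> ball q r \<noteq> {}"
      using q(2) r(1) by (metis centre_in_ball closure_iff_nhds_not_empty open_ball open_contains_ball_eq order_refl)
    have "G w = 0" if "w \<in> l ` ball q r" for w
    proof (rule analytic_continuation_open[where s = "l ` (Z \<inter> ball q r)" and s' = "l ` ball q r" and f = G
          and g = "\<lambda>_. 0" and z = w])
      show "open (l ` (Z \<inter> ball q r))" "open (l ` ball q r)"
        by (intro open_surjective_linear_image[OF _ l] open_Int Z(1) open_ball)+
      show "connected (l ` ball q r)"
        by (intro connected_continuous_image linear_continuous_on) (use l in \<open>auto simp: linear_linear\<close>)
      show "G z = 0" if "z \<in> l ` (Z \<inter> ball q r)" for z
        using that G(2) Z(3) by force
    qed (use \<open>Z \<inter> ball q r \<noteq> {}\<close> G that in auto)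
    then have "ball q r \<subseteq> {p \<in> P. g p = 0}" using G(2) r by auto
    then show ?thesis
      unfolding Z_def using r(1) by (meson centre_in_ball interior_maximal open_ball subsetD)
  qed
  \<comment> \<open>By \<open>cl\<close>, the open sets \<open>Z\<close> and
    \<open>- closure Z\<close> cover the connected set \<open>P\<close>.\<close>
  have "Z \<inter> P = {} \<or> (- closure Z) \<inter> P = {}"
    by (rule connectedD[OF P(2) Z(1)]) (use cl closure_subset[of Z] in auto)
  then have "P \<subseteq> closure Z" using V(2,3) \<open>V \<subseteq> Z\<close> by auto
  then show ?thesis using cl Z(3) \<open>p \<in> P\<close> by blast
qed

text \<open>The function \<open>G\<close> is found on \<Omega>, where directional convexity holds.
  Since \<open>l\<close> takes no new values on \<open>P\<close>, the difference g - G o l makes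
  sense there and is killed by the identity theorem.\<close>

lemma dir_diff_factors_extended:
  fixes g :: "'v::euclidean_space \<Rightarrow> complex"
  assumes l: "linear l" "surj l" and P: "open P" "connected P"
    and g: "dir_diff l P g" "continuous_on P g"
    and \<Omega>: "open \<Omega>" "\<Omega> \<noteq> {}" "\<Omega> \<subseteq> P" "convex_in_direction {h. l h = 0} \<Omega>" "l ` P \<subseteq> l ` \<Omega>"
  obtains G where "G holomorphic_on l ` \<Omega>" "\<And>p. p \<in> P \<Longrightarrow> g p = G (l p)"
proof -
  obtain G where G: "G holomorphic_on l ` \<Omega>" "\<And>p. p \<in> \<Omega> \<Longrightarrow> g p = G (l p)"
    using dir_diff_factors[OF l \<Omega>(1,4) dir_diff_subset[OF g(1) \<Omega>(3)] continuous_on_subset[OF g(2) \<Omega>(3)]]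
    by blast
  have oD: "open (l ` \<Omega>)" using open_surjective_linear_image[OF \<Omega>(1) l] .
  have "continuous_on P (\<lambda>p. g p - G (l p))"
    by (intro continuous_intros g continuous_on_compose2[OF holomorphic_on_imp_continuous_on[OF G(1)]]
        linear_continuous_on) (use l \<Omega>(5) in \<open>auto simp: linear_linear\<close>)
  then have "g p - G (l p) = 0" if "p \<in> P" for p
    by (rule dir_diff_eq_0[OF l P dir_diff_diff[OF g(1) dir_diff_holomorphic[OF l(1) G(1) oD \<Omega>(5)]] _ \<Omega>(1,2,3)])
       (use G that in auto)
  then show ?thesis using that G(1) by auto
qed

section \<open>Algebras with a Cartan basis\<close>

text \<open>The constant is the minimum of the norm of \<open>f\<close> on the unit sphere. It makes
  the inverse of \<open>zvar\<close> Lipschitz.\<close>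

lemma linear_inj_bounded_below_euclidean:
  fixes f :: "'a::euclidean_space \<Rightarrow> 'b::real_normed_vector"
  assumes f: "linear f" "inj f"
  obtains K where "K > 0" "\<And>x. K * norm x \<le> norm (f x)"
proof -
  obtain b :: 'a where "b \<in> Basis" using nonempty_Basis by blast
  then have "sphere (0::'a) 1 \<noteq> {}" by (metis norm_Basis mem_sphere_0 empty_iff)
  then obtain z where z: "z \<in> sphere 0 1" "\<And>y. y \<in> sphere 0 1 \<Longrightarrow> norm (f z) \<le> norm (f y)"
    using continuous_attains_inf[of "sphere (0::'a) 1" "\<lambda>x. norm (f x)"] compact_sphere
      continuous_on_norm[OF linear_continuous_on[of f]] f(1) linear_linear by (metis linear_conv_bounded_linear)
  show ?thesis
  proof
    have "z \<noteq> 0" using z(1) by auto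
    then show "norm (f z) > 0" using f linear_injective_0 by auto
    fix x show "norm (f z) * norm x \<le> norm (f x)"
    proof (cases "x = 0")
      case False
      then have "norm (f z) \<le> norm (f (x /\<^sub>R norm x))" by (intro z(2)) auto
      then show ?thesis using False by (simp add: linear_scale[OF f(1)] field_simps)
    qed (simp add: linear_0[OF f(1)])
  qed
qed

lemma scaleC_0_right [simp]: "c *\<^sub>C 0 = (0::'a::complex_comm_algebra_1)"
  and scaleC_0_left [simp]: "0 *\<^sub>C x = (0::'a::complex_comm_algebra_1)"
  by (rule cvec.scale_zero_right cvec.scale_zero_left)+

lemma scaleC_mult_right: "x * (c *\<^sub>C y) = c *\<^sub>C (x * (y::'a::complex_comm_algebra_1))"
  by (metis mult.commute scaleC_mult_left)

lemma mult_scaleC_scaleC: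
  "(c *\<^sub>C x) * (d *\<^sub>C y) = (c * d) *\<^sub>C (x * (y::'a::complex_comm_algebra_1))"
  by (simp add: scaleC_mult_left scaleC_mult_right scaleC_scaleC mult.commute)

lemma of_nat_scaleC: "of_nat k * x = of_nat k *\<^sub>C (x::'a::complex_comm_algebra_1)"
  by (induction k) (simp_all add: distrib_right scaleC_add_left scaleC_one)

lemma bounded_linear_scaleC_left: "bounded_linear (\<lambda>c. c *\<^sub>C (x::'a::complex_comm_algebra_1))"
proof -
  have "(\<lambda>c. c *\<^sub>C x) = (\<lambda>c. Re c *\<^sub>R x + Im c *\<^sub>R (\<i> *\<^sub>C x))"
  proof
    fix c
    have "c *\<^sub>C x = (of_real (Re c) + of_real (Im c) * \<i>) *\<^sub>C x"
      by (metis complex_eq mult.commute)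
    then show "c *\<^sub>C x = Re c *\<^sub>R x + Im c *\<^sub>R (\<i> *\<^sub>C x)"
      by (simp only: scaleC_add_left scaleR_eq_scaleC scaleC_scaleC)
  qed
  then show ?thesis
    by (simp add: bounded_linear_add bounded_linear_compose[OF bounded_linear_scaleR_left]
        bounded_linear_Re bounded_linear_Im)
qed

text \<open>Agreement after multiplication by \<open>e\<close> is preserved by sums and products. It
  is applied with the complementary idempotents \<open>I u\<close> and
  \<open>1 - I u\<close>.\<close>

lemma mult_char_poly3_cong:
  assumes "e * q = e * q'" "e * r = e * r'"
  shows "e * char_poly3 N C 1 q r = e * char_poly3 N C 1 q' r'"
proof -
  have pow: "e * x ^ k = e * y ^ k" if "e * x = e * y" for x y and k
  proof (induction k)
    case (Suc k)
    have "e * x ^ Suc k = x * (e * x ^ k)" by (simp add: mult_ac)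
    also have "\<dots> = (e * x) * y ^ k" unfolding Suc by (simp add: mult_ac)
    finally show ?case unfolding that by (simp add: mult_ac)
  qed simp
  have "e * (q ^ \<beta> * r ^ \<gamma>) = e * (q' ^ \<beta> * r' ^ \<gamma>)" for \<beta> \<gamma>
  proof -
    have "e * (q ^ \<beta> * r ^ \<gamma>) = (e * q' ^ \<beta>) * r ^ \<gamma>"
      using pow[OF assms(1)] by (simp flip: mult.assoc)
    also have "\<dots> = q' ^ \<beta> * (e * r' ^ \<gamma>)"
      unfolding pow[OF assms(2), symmetric] by (simp add: mult_ac)
    finally show ?thesis by (simp add: mult_ac)
  qed
  then show ?thesis
    unfolding char_poly3_def sum_distrib_left
    by (intro sum.cong refl) (simp add: scaleR_eq_scaleC scaleC_mult_right case_prod_unfold)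
qed

locale cartan_algebra =
  fixes n m :: nat and I :: "nat \<Rightarrow> 'a::complex_comm_algebra_1"
  assumes cartan: "cartan_basis n m I"
begin

abbreviation c :: "nat \<Rightarrow> 'a \<Rightarrow> complex" where "c \<equiv> coord n I"

lemma m_bounds: "1 \<le> m" "m \<le> n" and inj_basis: "inj_on I {1..n}"
  and indep_basis: "cvec.independent (I ` {1..n})" and span_basis: "cvec.span (I ` {1..n}) = UNIV"
  and idem_basis_mult: "\<And>r s. r \<in> {1..m} \<Longrightarrow> s \<in> {1..m} \<Longrightarrow> I r * I s = (if r = s then I r else 0)"
  using cartan by (auto simp: cartan_basis_def)

lemma nil_basis_mult: "\<exists>\<Upsilon>. \<forall>r\<in>{m+1..n}. \<forall>s\<in>{m+1..n}. I r * I s = (\<Sum>k=max r s + 1..n. \<Upsilon> r s k *\<^sub>C I k)"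
  using cartan by (simp only: cartan_basis_def)

lemma idem_nil: "r \<in> {1..m} \<Longrightarrow> s \<in> {m+1..n} \<Longrightarrow> I r * I s = I s \<or> I r * I s = 0"
  using cartan unfolding cartan_basis_def by metis

lemma expand: "x = (\<Sum>k=1..n. c k x *\<^sub>C I k)"
proof -
  have "(\<Sum>b\<in>I ` {1..n}. cvec.representation (I ` {1..n}) x b *\<^sub>C b) = x"
    by (rule cvec.sum_representation_eq) (use indep_basis span_basis in auto)
  then show ?thesis
    by (simp only: sum.reindex[OF inj_basis] coord_def o_def)
qed

lemma coord_add: "c k (x + y) = c k x + c k y"
  and coord_diff: "c k (x - y) = c k x - c k y"
  and coord_scaleC: "c k (z *\<^sub>C x) = z * c k x"
  and coord_0 [simp]: "c k 0 = 0"
  and coord_sum: "c k (sum f A) = (\<Sum>i\<in>A. c k (f i))"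
  using indep_basis span_basis by (simp_all add: coord_def cvec.representation_add cvec.representation_diff
      cvec.representation_scale cvec.representation_zero cvec.representation_sum)

lemma coord_scaleR: "c k (r *\<^sub>R x) = of_real r * c k x"
  by (simp add: scaleR_eq_scaleC coord_scaleC)

lemma coord_basis: "k \<in> {1..n} \<Longrightarrow> j \<in> {1..n} \<Longrightarrow> c k (I j) = (if k = j then 1 else 0)"
  using indep_basis inj_basis by (auto simp: coord_def cvec.representation_basis inj_on_eq_iff)

lemma coord_sum_basis:
  assumes "k \<in> {1..n}" "A \<subseteq> {1..n}"
  shows "c k (\<Sum>j\<in>A. f j *\<^sub>C I j) = (if k \<in> A then f k else 0)"
proof -
  have "finite A" using assms(2) finite_subset by blast
  have "c k (\<Sum>j\<in>A. f j *\<^sub>C I j) = (\<Sum>j\<in>A. if k = j then f j else 0)"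
    unfolding coord_sum coord_scaleC using assms by (intro sum.cong) (auto simp: coord_basis)
  then show ?thesis using \<open>finite A\<close> by simp
qed

lemma coord_eq_0_iff: "(\<forall>k\<in>{1..n}. c k x = 0) \<longleftrightarrow> x = 0"
proof
  assume "\<forall>k\<in>{1..n}. c k x = 0"
  then show "x = 0" by (subst expand) simp
qed simp

text \<open>If the coordinates are scaled so that the largest one, with index \<open>k\<close>, has
  modulus 1, the coefficient family lies in the compact set \<open>T k\<close>. There the norm of
  the combination is nonzero by linear independence, hence bounded below.\<close>

lemma coord_bounded: "\<exists>K. \<forall>x. \<forall>k\<in>{1..n}. norm (c k x) \<le> K * norm x"
proof -
  \<comment> \<open>Coefficients are functions on all of \<open>nat\<close>; the irrelevant ones are
    pinned to 0, so that the product of compact sets is compact.\<close>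
  define T where "T k = (PiE UNIV (\<lambda>j. if j = k then sphere 0 1 else if j \<in> {1..n} then cball 0 1 else {0})
      :: (nat \<Rightarrow> complex) set)" for k
  have "compactin euclidean (T k)" for k
    unfolding T_def euclidean_product_topology[symmetric] compactin_PiE
    by auto
  then have T: "compact (T k)" for k by simp
  define \<Lambda> where "\<Lambda> a = (\<Sum>k=1..n. a k *\<^sub>C I k)" for a
  have cont: "continuous_on S (\<lambda>a. norm (\<Lambda> a))" for S
    unfolding \<Lambda>_def
    by (intro continuous_intros bounded_linear.continuous_on[OF bounded_linear_scaleC_left]
        continuous_on_subset[OF continuous_on_product_coordinates]) auto
  have "\<exists>e>0. \<forall>a\<in>T k. e \<le> norm (\<Lambda> a)" if k: "k \<in> {1..n}" for k
  proof -
    have "(\<lambda>j. if j = k then 1 else 0) \<in> T k" by (auto simp: T_def)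
    then obtain a where a: "a \<in> T k" "\<And>b. b \<in> T k \<Longrightarrow> norm (\<Lambda> a) \<le> norm (\<Lambda> b)"
      using continuous_attains_inf[OF T _ cont] by blast
    have "norm (a k) = 1" using a(1) by (auto simp: T_def PiE_iff dest!: spec[of _ k])
    moreover have "c k (\<Lambda> a) = a k" unfolding \<Lambda>_def using k by (subst coord_sum_basis) auto
    ultimately have "\<Lambda> a \<noteq> 0" by auto
    then show ?thesis using a by (intro exI[of _ "norm (\<Lambda> a)"]) auto
  qed
  then obtain e where e: "\<And>k. k \<in> {1..n} \<Longrightarrow> e k > 0" "\<And>k a. k \<in> {1..n} \<Longrightarrow> a \<in> T k \<Longrightarrow> e k \<le> norm (\<Lambda> a)"
    by metis
  have "norm (c j x) \<le> (\<Sum>k=1..n. 1 / e k) * norm x" if j: "j \<in> {1..n}" for j x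
  proof -
    have "Max ((\<lambda>k. norm (c k x)) ` {1..n}) \<in> (\<lambda>k. norm (c k x)) ` {1..n}"
      using j by (intro Max_in) auto
    then obtain k where k: "k \<in> {1..n}" "norm (c k x) = Max ((\<lambda>k. norm (c k x)) ` {1..n})"
      by auto
    then have max: "norm (c i x) \<le> norm (c k x)" if "i \<in> {1..n}" for i
      using that by simp
    show ?thesis
    proof (cases "c k x = 0")
      case True
      then have "norm (c j x) \<le> 0" using max[OF j] by simp
      also have "0 \<le> (\<Sum>k=1..n. 1 / e k) * norm x"
        by (intro mult_nonneg_nonneg sum_nonneg) (auto simp: e(1) less_imp_le)
      finally show ?thesis .
    next
      case False
      define M where "M = norm (c k x)"
      have M: "M > 0" using False by (simp add: M_def)
      define a where "a i = (if i \<in> {1..n} then c i x /\<^sub>R M else 0)" for i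
      have "a \<in> T k"
        using k max M by (auto simp: T_def a_def M_def field_simps)
      then have "e k \<le> norm (\<Lambda> a)" using e k by blast
      also have "\<Lambda> a = (1 / M) *\<^sub>R (\<Sum>k=1..n. c k x *\<^sub>C I k)"
        unfolding \<Lambda>_def a_def scaleR_sum_right
        by (intro sum.cong) (auto simp: scaleR_eq_scaleC scaleC_scaleC scaleR_conv_of_real divide_inverse)
      also have "\<dots> = (1 / M) *\<^sub>R x"
        by (simp only: expand[symmetric])
      finally have "M \<le> 1 / e k * norm x" using M e(1)[OF k(1)] by (simp add: field_simps)
      also have "1 / e k \<le> (\<Sum>k=1..n. 1 / e k)"
        by (rule member_le_sum) (use k e(1) in \<open>auto intro: less_imp_le\<close>)
      finally show ?thesis
        using max[OF j] by (simp add: M_def mult_right_mono)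
    qed
  qed
  then show ?thesis by blast
qed

lemma bounded_linear_coord:
  assumes "k \<in> {1..n}"
  shows "bounded_linear (c k)"
proof -
  obtain K where "\<And>x. norm (c k x) \<le> K * norm x"
    using coord_bounded assms by blast
  then show ?thesis
    by (intro bounded_linear_intro[of _ K])
       (auto simp: coord_add coord_scaleR scaleR_conv_of_real mult.commute)
qed

lemma mult_expand: "x * y = (\<Sum>k=1..n. \<Sum>l=1..n. (c k x * c l y) *\<^sub>C (I k * I l))"
proof -
  have "x * y = (\<Sum>k=1..n. c k x *\<^sub>C I k) * (\<Sum>l=1..n. c l y *\<^sub>C I l)"
    by (simp only: expand[symmetric])
  then show ?thesis
    by (simp only: sum_product mult_scaleC_scaleC)
qed

text \<open>Joint continuity and the product rule in the algebra come from here: the constant is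
  assembled from the bounds on the coordinates and the finitely many products of basis
  elements.\<close>

lemma bounded_bilinear_mult: "bounded_bilinear ((*) :: 'a \<Rightarrow> 'a \<Rightarrow> 'a)"
proof
  fix a a' b b' :: 'a and r :: real
  show "(a + a') * b = a * b + a' * b" "a * (b + b') = a * b + a * b'"
    by (simp_all add: algebra_simps)
  show "r *\<^sub>R a * b = r *\<^sub>R (a * b)" "a * r *\<^sub>R b = r *\<^sub>R (a * b)"
    by (simp_all add: scaleR_eq_scaleC scaleC_mult_left scaleC_mult_right)
  obtain K where K: "\<And>x k. k \<in> {1..n} \<Longrightarrow> norm (c k x) \<le> K * norm x"
    using coord_bounded by blast
  have "\<exists>L. \<forall>z. norm (z *\<^sub>C v) \<le> norm z * L" for v :: 'a
    using bounded_linear.bounded[OF bounded_linear_scaleC_left] by blast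
  then obtain L where L: "\<And>z (v::'a). norm (z *\<^sub>C v) \<le> norm z * L v" by metis
  show "\<exists>K. \<forall>a b::'a. norm (a * b) \<le> norm a * norm b * K"
  proof (intro exI allI)
    fix a b :: 'a
    have L0: "0 \<le> L v" for v using order.trans[OF norm_ge_zero L[of 1 v]] by simp
    have "norm (a * b) = norm (\<Sum>k=1..n. \<Sum>l=1..n. (c k a * c l b) *\<^sub>C (I k * I l))"
      by (simp only: mult_expand[symmetric])
    also have "\<dots> \<le> (\<Sum>k=1..n. \<Sum>l=1..n. (norm a * norm b) * (K * K * L (I k * I l)))"
    proof (intro sum_norm_le)
      fix k l assume kl: "k \<in> {1..n}" "l \<in> {1..n}"
      have "norm ((c k a * c l b) *\<^sub>C (I k * I l)) \<le> norm (c k a) * norm (c l b) * L (I k * I l)"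
        using L[of "c k a * c l b"] by (simp add: norm_mult)
      also have "\<dots> \<le> (K * norm a) * (K * norm b) * L (I k * I l)"
        using kl K L0 by (intro mult_right_mono mult_mono) (auto intro: order.trans[OF norm_ge_zero])
      finally show "norm ((c k a * c l b) *\<^sub>C (I k * I l)) \<le> (norm a * norm b) * (K * K * L (I k * I l))"
        by (simp add: mult_ac)
    qed
    finally show "norm (a * b) \<le> norm a * norm b * (\<Sum>k=1..n. \<Sum>l=1..n. K * K * L (I k * I l))"
      by (simp add: sum_distrib_left)
  qed
qed

lemma bounded_bilinear_scaleC: "bounded_bilinear ((*\<^sub>C) :: complex \<Rightarrow> 'a \<Rightarrow> 'a)"
proof -
  have "bounded_bilinear (\<lambda>c x. (c *\<^sub>C 1) * (x::'a))"
    by (rule bounded_bilinear.comp1[OF bounded_bilinear_mult bounded_linear_scaleC_left])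
  then show ?thesis by (simp add: scaleC_mult_left)
qed

lemma coord_mult: "c i (x * y) = (\<Sum>k=1..n. \<Sum>l=1..n. c k x * c l y * c i (I k * I l))"
  by (subst mult_expand) (simp only: coord_sum coord_scaleC)

lemma coord_basis_mult_nil:
  assumes "k \<in> {m+1..n}" "l \<in> {m+1..n}" "i \<in> {1..n}" "i \<le> max k l"
  shows "c i (I k * I l) = 0"
proof -
  obtain \<Upsilon> where "I k * I l = (\<Sum>j=max k l + 1..n. \<Upsilon> k l j *\<^sub>C I j)"
    using nil_basis_mult assms by blast
  then show ?thesis
    using assms(3,4) by (simp add: coord_sum_basis)
qed

lemma coord_basis_mult_idem:
  assumes "k \<in> {1..m}" "l \<in> {m+1..n}" "i \<in> {1..n}" "i \<noteq> l"
  shows "c i (I k * I l) = 0"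
  using idem_nil[OF assms(1,2)] assms m_bounds by (auto simp: coord_basis)

text \<open>Among products of basis elements only \<open>I u * I u\<close> has a nonzero
  \<open>u\<close>-th coordinate: a nilpotent factor keeps a product in the nilpotent part, and
  distinct idempotents annihilate each other.\<close>

lemma coord_multiplicative:
  assumes u: "u \<in> {1..m}"
  shows "c u (x * y) = c u x * c u y"
proof -
  have *: "c u (I k * I l) = (if k = u \<and> l = u then 1 else 0)" if kl: "k \<in> {1..n}" "l \<in> {1..n}" for k l
  proof -
    have un: "u \<in> {1..n}" "u \<le> m" using u m_bounds by auto
    consider "k \<in> {1..m}" "l \<in> {1..m}" | "k \<in> {1..m}" "l \<in> {m+1..n}" | "k \<in> {m+1..n}" "l \<in> {1..m}"
      | "k \<in> {m+1..n}" "l \<in> {m+1..n}" using kl by fastforce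
    then show ?thesis
    proof cases
      case 1
      then show ?thesis using kl un by (auto simp: idem_basis_mult coord_basis)
    next
      case 2
      then have "c u (I k * I l) = 0" by (intro coord_basis_mult_idem un) (use un in auto)
      then show ?thesis using 2 un by auto
    next
      case 3
      then have "c u (I l * I k) = 0" by (intro coord_basis_mult_idem un) (use un in auto)
      then show ?thesis using 3 un by (auto simp: mult.commute)
    next
      case 4
      then have "c u (I k * I l) = 0" by (intro coord_basis_mult_nil un) (use un in auto)
      then show ?thesis using 4 un by auto
    qed
  qed
  have "c u (x * y) = (\<Sum>k=1..n. \<Sum>l=1..n. if k = u then (if l = u then c k x * c l y else 0) else 0)"
    by (subst coord_mult, intro sum.cong refl, subst *) auto
  also have "\<dots> = (\<Sum>k=1..n. if k = u then c k x * c u y else 0)"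
    using u m_bounds by (intro sum.cong refl) auto
  also have "\<dots> = c u x * c u y"
    using u m_bounds by simp
  finally show ?thesis .
qed

text \<open>Multiplicativity at \<open>I u * 1\<close> gives this without expanding the unit in the
  basis.\<close>

lemma coord_1: "u \<in> {1..m} \<Longrightarrow> c u 1 = 1"
  using coord_multiplicative[of u "I u" 1] coord_basis[of u u] m_bounds by simp

text \<open>The filtration behind the induction: the span of the basis elements with index at least
  \<open>j\<close>. In particular \<open>tail (Suc m)\<close> is the nilpotent subalgebra, and the
  filtration ends at 0 beyond \<open>n\<close>.\<close>

definition tail :: "nat \<Rightarrow> 'a set" where
  "tail j = {x. \<forall>k\<in>{1..n}. k < j \<longrightarrow> c k x = 0}"

lemma tailD: "x \<in> tail j \<Longrightarrow> k \<in> {1..n} \<Longrightarrow> k < j \<Longrightarrow> c k x = 0"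
  by (simp add: tail_def)

lemma tail_mono: "i \<le> j \<Longrightarrow> tail j \<subseteq> tail i"
  by (auto simp: tail_def)

lemma tail_add: "x \<in> tail j \<Longrightarrow> y \<in> tail j \<Longrightarrow> x + y \<in> tail j"
  and tail_diff: "x \<in> tail j \<Longrightarrow> y \<in> tail j \<Longrightarrow> x - y \<in> tail j"
  and tail_scaleC: "x \<in> tail j \<Longrightarrow> z *\<^sub>C x \<in> tail j"
  and tail_scaleR: "x \<in> tail j \<Longrightarrow> r *\<^sub>R x \<in> tail j"
  by (auto simp: tail_def coord_add coord_diff coord_scaleC coord_scaleR)

lemma tail_sum: "(\<And>i. i \<in> A \<Longrightarrow> f i \<in> tail j) \<Longrightarrow> sum f A \<in> tail j"
  by (auto simp: tail_def coord_sum)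

lemma tail_basis: "j \<in> {1..n} \<Longrightarrow> I j \<in> tail j"
  by (auto simp: tail_def coord_basis)

lemma tail_eq_0: "x \<in> tail j \<Longrightarrow> n < j \<Longrightarrow> x = 0"
  using coord_eq_0_iff[of x] by (auto simp: tail_def)

text \<open>Beyond \<open>m\<close> the filtration consists of ideals: a basis idempotent fixes or
  kills a nilpotent basis element, and a nilpotent one raises its index.\<close>

lemma tail_mult:
  assumes "y \<in> tail j" "m < j"
  shows "x * y \<in> tail j"
  unfolding tail_def
proof safe
  fix i assume i: "i \<in> {1..n}" "i < j"
  have "c k x * c l y * c i (I k * I l) = 0" if "k \<in> {1..n}" "l \<in> {1..n}" for k l
  proof (cases "l < j")
    case False
    then have "c i (I k * I l) = 0"
      using that i \<open>m < j\<close>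
      by (cases "k \<le> m") (auto intro: coord_basis_mult_nil coord_basis_mult_idem)
    then show ?thesis by simp
  qed (use tailD[OF assms(1)] that in auto)
  then show "c i (x * y) = 0" by (subst coord_mult) (simp add: sum.neutral)
qed

text \<open>The gain of one step comes from the strict lower limit max r s + 1 in the products of
  nilpotent basis elements.\<close>

lemma tail_mult_Suc:
  assumes "x \<in> tail (Suc m)" "y \<in> tail j" "m < j"
  shows "x * y \<in> tail (Suc j)"
  unfolding tail_def
proof safe
  fix i assume i: "i \<in> {1..n}" "i < Suc j"
  have "c k x * c l y * c i (I k * I l) = 0" if "k \<in> {1..n}" "l \<in> {1..n}" for k l
  proof (cases "k < Suc m \<or> l < j")
    case False
    then have "c i (I k * I l) = 0"
      using that i \<open>m < j\<close> by (intro coord_basis_mult_nil) auto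
    then show ?thesis by simp
  qed (use tailD[OF assms(1)] tailD[OF assms(2)] that in auto)
  then show "c i (x * y) = 0" by (subst coord_mult) (simp add: sum.neutral)
qed

lemma tail_power_mult:
  assumes "x \<in> tail (Suc m)" "y \<in> tail j" "m < j"
  shows "x ^ i * y \<in> tail (j + i)"
proof (induction i)
  case (Suc i)
  then show ?case using tail_mult_Suc[OF assms(1) Suc] assms(3) by (simp add: mult.assoc)
qed (use assms in auto)

lemma Rad_tail: "Rad n m I x \<in> tail (Suc m)"
  unfolding Rad_def
  by (intro tail_sum tail_scaleC subsetD[OF tail_mono tail_basis]) auto

lemma expand_Rad: "x = (\<Sum>r=1..m. c r x *\<^sub>C I r) + Rad n m I x"
proof -
  have "{1..n} = {1..m} \<union> {m+1..n}" using m_bounds by auto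
  then show ?thesis
    unfolding Rad_def by (subst expand[of x]) (simp add: sum.union_disjoint)
qed

lemma idem_mult:
  assumes u: "u \<in> {1..m}"
  shows "I u * x = c u x *\<^sub>C I u + I u * Rad n m I x"
proof -
  have "I u * (\<Sum>r=1..m. c r x *\<^sub>C I r) = (\<Sum>r=1..m. if r = u then c u x *\<^sub>C I u else 0)"
    unfolding sum_distrib_left by (intro sum.cong refl) (use u in \<open>auto simp: scaleC_mult_right idem_basis_mult\<close>)
  then show ?thesis
    using u by (subst expand_Rad[of x]) (simp add: distrib_left)
qed

lemma unital_nil_memI: "x \<in> tail (Suc m) \<Longrightarrow> z *\<^sub>C 1 + x \<in> unital_nil_subalgebra n m I"
proof -
  assume "x \<in> tail (Suc m)"
  then have "(\<Sum>r=1..m. c r x *\<^sub>C I r) = 0"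
    using m_bounds by (intro sum.neutral) (auto dest!: tailD)
  then have "x = (\<Sum>r=m+1..n. c r x *\<^sub>C I r)"
    using expand_Rad[of x] by (simp add: Rad_def)
  then show ?thesis
    unfolding unital_nil_subalgebra_def
    by (metis (no_types, lifting) cvec.span_add cvec.span_base cvec.span_scale cvec.span_sum imageI insertCI)
qed

section \<open>The characteristic equation for the new vectors\<close>

lemma char_poly3_semisimple_part:
  assumes u: "u \<in> {1..m}"
  shows "char_poly3 N C 1 (c u q *\<^sub>C 1) (c u r *\<^sub>C 1) = c u (char_poly3 N C 1 q r) *\<^sub>C (1::'a)"
proof -
  have pow: "(w *\<^sub>C 1) ^ k = w ^ k *\<^sub>C (1::'a)" for w k
    by (induction k) (simp_all add: scaleC_one mult_scaleC_scaleC)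
  have coord_power: "c u (x ^ k) = c u x ^ k" for x k
    by (induction k) (simp_all add: coord_1[OF u] coord_multiplicative[OF u])
  show ?thesis
    unfolding char_poly3_def coord_sum cvec.scale_sum_left
    by (intro sum.cong refl)
       (simp add: case_prod_unfold coord_scaleC coord_multiplicative[OF u] coord_power coord_1[OF u] pow
         mult_scaleC_scaleC scaleR_eq_scaleC scaleC_scaleC mult_ac)
qed

text \<open>After multiplication by \<open>I u\<close> the new vectors coincide with
  \<open>q\<close> and \<open>r\<close>; after multiplication by \<open>1 - I u\<close> they
  coincide with the scalars f_u(q) and f_u(r), at which the polynomial takes the value f_u(0) = 0.
  The two products add up to the whole.\<close>

lemma char_poly3_transfer:
  assumes u: "u \<in> {1..m}" and 0: "char_poly3 N C 1 q r = 0"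
  shows "char_poly3 N C 1 (c u q *\<^sub>C 1 + I u * Rad n m I q) (c u r *\<^sub>C 1 + I u * Rad n m I r) = 0"
    (is "?X = 0")
proof -
  have II: "I u * (I u * x) = I u * x" for x
    using idem_basis_mult u by (simp flip: mult.assoc)
  have "I u * ?X = I u * char_poly3 N C 1 q r"
    by (rule mult_char_poly3_cong)
       (simp_all add: idem_mult[OF u, of q] idem_mult[OF u, of r] distrib_left II scaleC_mult_right)
  moreover have "(1 - I u) * ?X = (1 - I u) * char_poly3 N C 1 (c u q *\<^sub>C 1) (c u r *\<^sub>C 1)"
    by (rule mult_char_poly3_cong) (simp_all add: distrib_left left_diff_distrib II)
  ultimately show ?thesis
    by (simp add: 0 char_poly3_semisimple_part[OF u] left_diff_distrib)
qed

subsection \<open>Taylor extensions of holomorphic functions\<close>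

lemma has_vector_derivative_power_line:
  "((\<lambda>t. (x + t *\<^sub>R y :: 'a) ^ j) has_vector_derivative of_nat j * x ^ (j - 1) * y) (at 0)"
proof (induction j)
  case (Suc j)
  have "((\<lambda>t. x + t *\<^sub>R y) has_vector_derivative y) (at 0)"
    by (auto intro!: derivative_eq_intros)
  from bounded_bilinear.has_vector_derivative[OF bounded_bilinear_mult this Suc]
  have "((\<lambda>t. (x + t *\<^sub>R y) ^ Suc j) has_vector_derivative
          x * (of_nat j * x ^ (j - 1) * y) + y * x ^ j) (at 0)"
    by simp
  moreover have "x * (of_nat j * x ^ (j - 1) * y) + y * x ^ j = of_nat (Suc j) * x ^ (Suc j - 1) * y"
    by (cases j) (simp_all add: algebra_simps)
  ultimately show ?case by simp
qed simp

lemma continuous_on_mult_alg: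
  assumes "continuous_on S f" "continuous_on S g"
  shows "continuous_on S (\<lambda>x. f x * g x :: 'a)"
  by (rule bounded_bilinear.continuous_on[OF bounded_bilinear_mult assms])

lemma continuous_on_power_alg:
  assumes "continuous_on S f"
  shows "continuous_on S (\<lambda>x. f x ^ j :: 'a)"
  by (induction j) (auto intro!: continuous_on_mult_alg assms)

lemma bounded_linear_mult_right: "bounded_linear (\<lambda>x. y * x :: 'a)"
  and bounded_linear_mult_left: "bounded_linear (\<lambda>x. x * y :: 'a)"
  by (rule bounded_bilinear.bounded_linear_right[OF bounded_bilinear_mult]
      bounded_bilinear.bounded_linear_left[OF bounded_bilinear_mult])+

lemma unital_nil_add:
  "x \<in> unital_nil_subalgebra n m I \<Longrightarrow> y \<in> unital_nil_subalgebra n m I \<Longrightarrow>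
   x + y \<in> unital_nil_subalgebra n m I"
  unfolding unital_nil_subalgebra_def by (rule cvec.span_add)

text \<open>The extension of the holomorphic map $w \mapsto G(w) v$ to elements $\zeta = w + \nu$ with $w$
  complex and $\nu$ nilpotent.  All powers of $\nu$ beyond the $n$-th vanish.\<close>

definition taylor :: "nat \<Rightarrow> (complex \<Rightarrow> complex) \<Rightarrow> 'a \<Rightarrow> 'a \<Rightarrow> 'a" where
  "taylor u G v \<zeta> = (\<Sum>j\<le>n. ((deriv ^^ j) G (c u \<zeta>) / fact j) *\<^sub>C ((\<zeta> - c u \<zeta> *\<^sub>C 1) ^ j * v))"

lemma taylor_leading:
  assumes "\<And>i. (\<zeta> - c u \<zeta> *\<^sub>C 1) ^ Suc i * v \<in> tail s"
  shows "taylor u G v \<zeta> - G (c u \<zeta>) *\<^sub>C v \<in> tail s"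
proof -
  have "taylor u G v \<zeta> - G (c u \<zeta>) *\<^sub>C v =
      (\<Sum>i<n. ((deriv ^^ Suc i) G (c u \<zeta>) / fact (Suc i)) *\<^sub>C ((\<zeta> - c u \<zeta> *\<^sub>C 1) ^ Suc i * v))"
    unfolding taylor_def sum.atMost_shift by simp
  then show ?thesis
    using assms by (auto intro!: tail_sum tail_scaleC simp del: power_Suc)
qed

lemma taylor_one_leading:
  assumes "\<zeta> - c u \<zeta> *\<^sub>C 1 \<in> tail (Suc m)"
  shows "taylor u G 1 \<zeta> - G (c u \<zeta>) *\<^sub>C 1 \<in> tail (Suc m)"
proof (rule taylor_leading)
  fix i
  have "(\<zeta> - c u \<zeta> *\<^sub>C 1) ^ i * (\<zeta> - c u \<zeta> *\<^sub>C 1) \<in> tail (Suc m + i)"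
    using assms by (intro tail_power_mult) auto
  then show "(\<zeta> - c u \<zeta> *\<^sub>C 1) ^ Suc i * 1 \<in> tail (Suc m)"
    using tail_mono[of "Suc m" "Suc m + i"] by (auto simp: mult.commute)
qed

text \<open>Every further power of the nilpotent part raises the filtration, so a Taylor extension
  with \<open>v = I j\<close> corrects the coordinate \<open>j\<close> by exactly G(f_u(\<zeta>))
  and leaves all earlier ones untouched.\<close>

lemma taylor_tail_leading:
  assumes "\<zeta> - c u \<zeta> *\<^sub>C 1 \<in> tail (Suc m)" "v \<in> tail j" "m < j"
  shows "taylor u G v \<zeta> - G (c u \<zeta>) *\<^sub>C v \<in> tail (Suc j)"
proof (rule taylor_leading)
  fix i
  show "(\<zeta> - c u \<zeta> *\<^sub>C 1) ^ Suc i * v \<in> tail (Suc j)"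
    using tail_power_mult[OF assms, of "Suc i"] tail_mono[of "Suc j" "j + Suc i"] by auto
qed

lemma taylor_mem:
  assumes "\<zeta> - c u \<zeta> *\<^sub>C 1 \<in> tail (Suc m)" "v = 1 \<or> v \<in> tail (Suc m)"
  shows "taylor u G v \<zeta> \<in> unital_nil_subalgebra n m I"
proof (cases "v = 1")
  case True
  then show ?thesis
    using unital_nil_memI[OF taylor_one_leading[OF assms(1)], of "G (c u \<zeta>)" G] by simp
next
  case False
  then have v: "v \<in> tail (Suc m)" using assms(2) by simp
  have "taylor u G v \<zeta> - G (c u \<zeta>) *\<^sub>C v \<in> tail (Suc m)"
    using taylor_tail_leading[OF assms(1) v] tail_mono[of "Suc m" "Suc (Suc m)"] by auto
  from tail_add[OF this tail_scaleC[OF v, of "G (c u \<zeta>)"]] have "taylor u G v \<zeta> \<in> tail (Suc m)" by simp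
  from unital_nil_memI[OF this, of 0] show ?thesis by simp
qed

lemma continuous_on_taylor:
  assumes "u \<in> {1..n}" "G holomorphic_on D" "open D"
  shows "continuous_on {\<zeta>. c u \<zeta> \<in> D} (taylor u G v)"
proof -
  have c: "continuous_on S (c u)" for S
    using bounded_linear.continuous_on[OF bounded_linear_coord[OF assms(1)]] continuous_on_id by blast
  have "continuous_on {\<zeta>. c u \<zeta> \<in> D} (\<lambda>\<zeta>. (deriv ^^ j) G (c u \<zeta>))" for j
    by (rule continuous_on_compose2[OF holomorphic_on_imp_continuous_on[OF holomorphic_higher_deriv] c])
       (use assms in auto)
  then show ?thesis
    unfolding taylor_def
    by (intro continuous_on_sum bounded_bilinear.continuous_on[OF bounded_bilinear_scaleC]
        continuous_on_mult_alg continuous_on_power_alg continuous_on_diff continuous_on_divide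
        bounded_linear.continuous_on[OF bounded_linear_scaleC_left] c continuous_on_const continuous_on_id)
      auto
qed

text \<open>Split h into its complex part k and its nilpotent part \<eta>. Differentiating the
  coefficients produces the k-part of the claim; differentiating the powers produces, after an index
  shift, the \<eta>-part.\<close>

lemma has_vector_derivative_taylor:
  assumes G: "G holomorphic_on D" "open D" "c u \<zeta> \<in> D"
    and \<nu>: "\<zeta> - c u \<zeta> *\<^sub>C 1 \<in> tail (Suc m)" and \<eta>: "h - c u h *\<^sub>C 1 \<in> tail (Suc m)"
  shows "((\<lambda>t. taylor u G v (\<zeta> + t *\<^sub>R h)) has_vector_derivative h * taylor u (deriv G) v \<zeta>) (at 0)"
proof -
  define w k \<nu> \<eta> where "w = c u \<zeta>" and "k = c u h" and "\<nu> = \<zeta> - w *\<^sub>C 1" and "\<eta> = h - k *\<^sub>C 1"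
  define d where "d j = (deriv ^^ j) G w" for j
  have nil: "\<nu> \<in> tail (Suc m)" "\<eta> \<in> tail (Suc m)"
    using \<nu> \<eta> by (simp_all add: \<nu>_def \<eta>_def w_def k_def)
  have line: "taylor u G v (\<zeta> + t *\<^sub>R h) =
      (\<Sum>j\<le>n. ((deriv ^^ j) G (w + t *\<^sub>R k) / fact j) *\<^sub>C ((\<nu> + t *\<^sub>R \<eta>) ^ j * v))" for t
  proof -
    have 1: "c u (\<zeta> + t *\<^sub>R h) = w + t *\<^sub>R k"
      by (simp add: coord_add coord_scaleR w_def k_def scaleR_conv_of_real)
    have 2: "\<zeta> + t *\<^sub>R h - (w + t *\<^sub>R k) *\<^sub>C 1 = \<nu> + t *\<^sub>R \<eta>"
      by (simp add: \<nu>_def \<eta>_def scaleC_add_left scaleR_eq_scaleC scaleC_scaleC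
          scaleR_conv_of_real cvec.scale_right_diff_distrib)
    show ?thesis unfolding taylor_def 1 2 ..
  qed
  define F where "F j = (d j / fact j) *\<^sub>C ((of_nat j * \<nu> ^ (j - 1) * \<eta>) * v)" for j
  define H where "H j = (d (Suc j) / fact j) *\<^sub>C (\<eta> * (\<nu> ^ j * v))" for j
  have "((\<lambda>t. taylor u G v (\<zeta> + t *\<^sub>R h)) has_vector_derivative
      (\<Sum>j\<le>n. F j + (k * d (Suc j) / fact j) *\<^sub>C (\<nu> ^ j * v))) (at 0)"
    unfolding line
  proof (rule has_vector_derivative_sum)
    fix j
    have "((\<lambda>t. (deriv ^^ j) G (w + t *\<^sub>R k)) has_vector_derivative k * deriv ((deriv ^^ j) G) w) (at 0)"
      using G by (intro has_vector_derivative_compose_holomorphic[of _ D] holomorphic_higher_deriv) (auto simp: w_def)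
    then have 1: "((\<lambda>t. (deriv ^^ j) G (w + t *\<^sub>R k) / fact j) has_vector_derivative k * d (Suc j) / fact j) (at 0)"
      unfolding d_def by (auto intro: has_vector_derivative_divide)
    have 2: "((\<lambda>t. (\<nu> + t *\<^sub>R \<eta>) ^ j * v) has_vector_derivative (of_nat j * \<nu> ^ (j - 1) * \<eta>) * v) (at 0)"
      by (rule bounded_linear.has_vector_derivative[OF bounded_linear_mult_left has_vector_derivative_power_line])
    show "((\<lambda>t. ((deriv ^^ j) G (w + t *\<^sub>R k) / fact j) *\<^sub>C ((\<nu> + t *\<^sub>R \<eta>) ^ j * v)) has_vector_derivative
        F j + (k * d (Suc j) / fact j) *\<^sub>C (\<nu> ^ j * v)) (at 0)"
      using bounded_bilinear.has_vector_derivative[OF bounded_bilinear_scaleC 1 2] by (simp add: F_def d_def)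
  qed
  also have "(\<Sum>j\<le>n. F j + (k * d (Suc j) / fact j) *\<^sub>C (\<nu> ^ j * v)) = h * taylor u (deriv G) v \<zeta>"
  proof -
    have "F (Suc j) = H j" for j
    proof -
      have "F (Suc j) = (d (Suc j) / fact (Suc j)) *\<^sub>C (of_nat (Suc j) *\<^sub>C (\<eta> * (\<nu> ^ j * v)))"
        unfolding F_def of_nat_scaleC[symmetric] by (simp add: mult_ac)
      then show ?thesis
        by (simp add: H_def scaleC_scaleC field_simps del: of_nat_Suc)
    qed
    then have "(\<Sum>j\<le>n. F j) = (\<Sum>j<n. H j)"
      unfolding sum.atMost_shift by (simp add: F_def)
    \<comment> \<open>The shift loses the top term, which vanishes: \<nu>^n times an element of
      \<open>tail (Suc m)\<close> lies in the filtration beyond \<open>n\<close>.\<close>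
    moreover have "H n = 0"
    proof -
      have "v * \<eta> \<in> tail (Suc m)" using nil by (intro tail_mult) auto
      from tail_power_mult[OF nil(1) this, of n] have "\<nu> ^ n * (v * \<eta>) = 0"
        by (intro tail_eq_0) auto
      then show ?thesis by (simp add: H_def mult_ac)
    qed
    ultimately have "(\<Sum>j\<le>n. F j) = (\<Sum>j\<le>n. H j)"
      by (simp add: lessThan_Suc_atMost[symmetric])
    moreover have "h * taylor u (deriv G) v \<zeta> =
        (\<Sum>j\<le>n. H j + (k * d (Suc j) / fact j) *\<^sub>C (\<nu> ^ j * v))"
    proof -
      have h: "h = \<eta> + k *\<^sub>C 1" by (simp add: \<eta>_def)
      have "(deriv ^^ j) (deriv G) w = d (Suc j)" for j
        by (simp add: d_def funpow_swap1)
      then have "h * taylor u (deriv G) v \<zeta> = (\<Sum>j\<le>n. h * ((d (Suc j) / fact j) *\<^sub>C (\<nu> ^ j * v)))"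
        unfolding taylor_def w_def[symmetric] \<nu>_def[symmetric] by (simp add: sum_distrib_left)
      then show ?thesis
        by (simp add: h H_def distrib_right scaleC_mult_left scaleC_mult_right scaleC_scaleC
            scaleC_add_right mult.commute[of _ k])
    qed
    ultimately show ?thesis by (simp add: sum.distrib)
  qed
  finally show ?thesis .
qed

lemma monogenic_on_taylor:
  assumes u: "u \<in> {1..n}" and G: "G holomorphic_on D" "open D"
    and U: "domain_in E U" "U \<subseteq> {\<zeta>. c u \<zeta> \<in> D}"
    and E: "E \<subseteq> {h. h - c u h *\<^sub>C 1 \<in> tail (Suc m)}" and v: "v = 1 \<or> v \<in> tail (Suc m)"
  shows "monogenic_on (unital_nil_subalgebra n m I) E U (taylor u G v)"
  unfolding monogenic_on_def
proof (intro conjI ballI)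
  have UE: "U \<subseteq> E" using U(1) openin_imp_subset unfolding domain_in_def by blast
  show "domain_in E U" by fact
  show "taylor u G v ` U \<subseteq> unital_nil_subalgebra n m I"
    using taylor_mem[OF _ v] UE E by blast
  show "continuous_on U (taylor u G v)"
    using continuous_on_taylor[OF u G] U(2) continuous_on_subset by blast
  fix \<zeta> assume \<zeta>: "\<zeta> \<in> U"
  have "((\<lambda>t. (taylor u G v (\<zeta> + t *\<^sub>R h) - taylor u G v \<zeta>) /\<^sub>R t) \<longlongrightarrow> h * taylor u (deriv G) v \<zeta>) (at_right 0)"
    if "h \<in> E" for h
  proof -
    have "((\<lambda>t. taylor u G v (\<zeta> + t *\<^sub>R h)) has_vector_derivative h * taylor u (deriv G) v \<zeta>) (at 0)"
      using G U \<zeta> UE E that by (intro has_vector_derivative_taylor[of G D]) blast+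
    then show ?thesis
      unfolding has_vector_derivative_at_0_iff by (simp add: filterlim_at_split)
  qed
  moreover have "taylor u (deriv G) v \<zeta> \<in> unital_nil_subalgebra n m I"
    using taylor_mem[OF _ v] UE E \<zeta> by blast
  ultimately show "\<exists>d\<in>unital_nil_subalgebra n m I. \<forall>h\<in>E.
      ((\<lambda>t. (taylor u G v (\<zeta> + t *\<^sub>R h) - taylor u G v \<zeta>) /\<^sub>R t) \<longlongrightarrow> h * d) (at_right 0)"
    by blast
qed

lemma monogenic_on_add:
  assumes f: "monogenic_on (unital_nil_subalgebra n m I) E U f"
    and g: "monogenic_on (unital_nil_subalgebra n m I) E U g"
  shows "monogenic_on (unital_nil_subalgebra n m I) E U (\<lambda>\<zeta>. f \<zeta> + g \<zeta>)"
  unfolding monogenic_on_def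
proof (intro conjI ballI)
  show "domain_in E U" using f by (simp add: monogenic_on_def)
  show "(\<lambda>\<zeta>. f \<zeta> + g \<zeta>) ` U \<subseteq> unital_nil_subalgebra n m I"
    using f g unital_nil_add unfolding monogenic_on_def by blast
  show "continuous_on U (\<lambda>\<zeta>. f \<zeta> + g \<zeta>)"
    using f g by (auto simp: monogenic_on_def intro: continuous_on_add)
  fix \<zeta> assume \<zeta>: "\<zeta> \<in> U"
  obtain d where d: "d \<in> unital_nil_subalgebra n m I"
    "\<And>h. h \<in> E \<Longrightarrow> ((\<lambda>t. (f (\<zeta> + t *\<^sub>R h) - f \<zeta>) /\<^sub>R t) \<longlongrightarrow> h * d) (at_right 0)"
    using f \<zeta> unfolding monogenic_on_def by blast
  obtain e where e: "e \<in> unital_nil_subalgebra n m I"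
    "\<And>h. h \<in> E \<Longrightarrow> ((\<lambda>t. (g (\<zeta> + t *\<^sub>R h) - g \<zeta>) /\<^sub>R t) \<longlongrightarrow> h * e) (at_right 0)"
    using g \<zeta> unfolding monogenic_on_def by blast
  have "((\<lambda>t. (f (\<zeta> + t *\<^sub>R h) + g (\<zeta> + t *\<^sub>R h) - (f \<zeta> + g \<zeta>)) /\<^sub>R t) \<longlongrightarrow> h * (d + e)) (at_right 0)"
    if "h \<in> E" for h
    using tendsto_add[OF d(2)[OF that] e(2)[OF that]] by (simp add: algebra_simps)
  then show "\<exists>d\<in>unital_nil_subalgebra n m I. \<forall>h\<in>E.
      ((\<lambda>t. (f (\<zeta> + t *\<^sub>R h) + g (\<zeta> + t *\<^sub>R h) - (f \<zeta> + g \<zeta>)) /\<^sub>R t) \<longlongrightarrow> h * d) (at_right 0)"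
    using unital_nil_add[OF d(1) e(1)] by blast
qed

end

section \<open>Transfer of monogenic functions\<close>

lemma linear_zvar: "linear (zvar p q)"
  by (rule linearI) (auto simp: zvar_def algebra_simps split: prod.splits)

lemma continuous_on_zvar: "continuous_on S (zvar p q)"
  using linear_zvar unfolding linear_conv_bounded_linear by (rule linear_continuous_on)

lemma zvar_mem_E3: "zvar p q x \<in> E3 p q"
  by (simp add: E3_def)

lemma inj_zvar:
  assumes "distinct [1, p, q]" "independent {1, p, q}"
  shows "inj (zvar p q)"
proof -
  have "v = 0" if v: "zvar p q v = 0" for v
  proof -
    obtain x y z where xyz: "v = (x, y, z)" by (metis prod_cases3)
    \<comment> \<open>\<open>distinct\<close> guarantees that the three coefficients belong to three
      different vectors; the set alone would hide coincidences.\<close>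
    define f where "f w = (if w = 1 then x else if w = p then y else z)" for w
    have ne: "1 \<noteq> p" "1 \<noteq> q" "p \<noteq> q" using assms(1) by auto
    have "(\<Sum>w\<in>{1, p, q}. f w *\<^sub>R w) = 0"
      using ne ne[symmetric] v by (simp add: f_def xyz zvar_def add.assoc)
    then have "f w = 0" if "w \<in> {1, p, q}" for w
      using independentD[OF assms(2), of "{1, p, q}" f w] that by auto
    from this[of 1] this[of p] this[of q] show ?thesis
      using ne ne[symmetric] by (simp add: f_def xyz zero_prod_def)
  qed
  then show ?thesis by (simp add: linear_injective_0[OF linear_zvar])
qed

text \<open>Openness needs only continuity of \<open>zvar\<close>; connectedness needs a continuous
  inverse, supplied by the lower bound for injective linear maps.\<close>

lemma domain_in_vimage_zvar:
  assumes inj: "inj (zvar p q)" and U: "domain_in (E3 p q) U"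
  shows "open {x. zvar p q x \<in> U}" "connected {x. zvar p q x \<in> U}"
proof -
  have UE: "U \<subseteq> E3 p q" using U openin_imp_subset unfolding domain_in_def by blast
  have "openin (top_of_set UNIV) (UNIV \<inter> zvar p q -` U)"
    by (rule continuous_openin_preimage[OF continuous_on_zvar, where T = "E3 p q"])
       (use U in \<open>auto simp: domain_in_def E3_def\<close>)
  then show "open {x. zvar p q x \<in> U}" by (simp add: vimage_def)
  obtain K where K: "K > 0" "\<And>x. K * norm x \<le> norm (zvar p q x)"
    using linear_inj_bounded_below_euclidean[OF linear_zvar inj] by blast
  have "(1 / K)-lipschitz_on U (inv (zvar p q))"
  proof (rule lipschitz_onI)
    fix x y assume "x \<in> U" "y \<in> U"
    then obtain v w where vw: "x = zvar p q v" "y = zvar p q w"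
      using UE unfolding E3_def by blast
    have "K * dist v w \<le> dist x y"
      using K(2)[of "v - w"] by (simp add: vw dist_norm linear_diff[OF linear_zvar])
    then show "dist (inv (zvar p q) x) (inv (zvar p q) y) \<le> 1 / K * dist x y"
      using K(1) by (simp add: vw inj field_simps)
  qed (use K in auto)
  then have "connected (inv (zvar p q) ` U)"
    using U by (intro connected_continuous_image lipschitz_on_continuous_on) (auto simp: domain_in_def)
  moreover have "inv (zvar p q) ` U = {x. zvar p q x \<in> U}"
  proof (intro equalityI subsetI)
    fix y assume "y \<in> inv (zvar p q) ` U"
    then obtain x where x: "x \<in> U" "y = inv (zvar p q) x" by blast
    then obtain v where "x = zvar p q v" using UE unfolding E3_def by blast
    then show "y \<in> {x. zvar p q x \<in> U}" using x inj by simp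
  next
    fix x assume "x \<in> {x. zvar p q x \<in> U}"
    then show "x \<in> inv (zvar p q) ` U"
      using inj by (intro image_eqI[of _ _ "zvar p q x"]) simp_all
  qed
  ultimately show "connected {x. zvar p q x \<in> U}" by simp
qed

text \<open>A single index \<open>u\<close> is fixed, and \<open>Q\<close> stands for the domain of
  \<Phi>. Of its construction as an intersection of cylinders only two facts enter: it contains the
  image of \<Omega>, and f_u takes no values on it beyond those on that image.\<close>

locale monogenic_cylinder = cartan_algebra n m I
  for n m and I :: "nat \<Rightarrow> 'a::complex_comm_algebra_1" +
  fixes u :: nat and e2 e3 e2' e3' :: 'a and \<Omega> :: "(real \<times> real \<times> real) set"
    and Q :: "'a set" and \<Phi> :: "'a \<Rightarrow> 'a"
  assumes u: "u \<in> {1..m}"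
    and e2': "e2' = c u e2 *\<^sub>C 1 + I u * Rad n m I e2"
    and e3': "e3' = c u e3 *\<^sub>C 1 + I u * Rad n m I e3"
    and inj_z: "inj (zvar e2 e3)"
    and surj_coord: "c u ` E3 e2 e3 = UNIV"
    and \<Omega>: "open \<Omega>" "connected \<Omega>" "\<Omega> \<noteq> {}" "convex_in_direction {p. c u (zvar e2 e3 p) = 0} \<Omega>"
    and Q: "\<Omega> \<subseteq> {p. zvar e2 e3 p \<in> Q}" "c u ` Q \<subseteq> c u ` zvar e2 e3 ` \<Omega>"
    and \<Phi>: "monogenic_on UNIV (E3 e2 e3) Q \<Phi>"
begin

abbreviation B where "B \<equiv> unital_nil_subalgebra n m I"
abbreviation z where "z \<equiv> zvar e2 e3"
abbreviation z' where "z' \<equiv> zvar e2' e3'"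

text \<open>The work is done in the real coordinates shared by both variables. \<open>D\<close> is
  the plane domain D_u, \<open>P\<close> the coordinate form of \<open>Q\<close>, and
  \<open>U\<close> the target cylinder; one functional \<open>l\<close> serves both variables
  because f_u agrees on them.\<close>

definition l where "l p = c u (z p)"
definition D where "D = l ` \<Omega>"
definition P where "P = {p. z p \<in> Q}"
definition U where "U = z' ` {p. l p \<in> D}"

lemma u_index: "u \<in> {1..n}" "u < Suc m"
  using u m_bounds by auto

lemma l_linear_surj: "linear l" "surj l"
proof -
  show "linear l"
    unfolding l_def using linear_compose[OF linear_zvar bounded_linear.linear[OF bounded_linear_coord[OF u_index(1)]]]
    by (simp add: o_def)
  have "range l = c u ` E3 e2 e3" by (auto simp: l_def E3_def)
  then show "surj l" using surj_coord by simp
qed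

lemma continuous_on_z: "continuous_on S z" "continuous_on S z'" "continuous_on S l"
  using l_linear_surj(1) by (auto intro: continuous_on_zvar linear_continuous_on simp: linear_conv_bounded_linear)

lemma open_D: "open D"
  unfolding D_def using open_surjective_linear_image[OF \<Omega>(1) l_linear_surj] .

lemma P_props: "open P" "connected P" "\<Omega> \<subseteq> P" "l ` P \<subseteq> l ` \<Omega>"
  using domain_in_vimage_zvar[OF inj_z, of Q] \<Phi> Q
  by (auto simp: P_def monogenic_on_def l_def image_subset_iff image_image)

lemma idem_Rad_tail: "I u * Rad n m I x \<in> tail (Suc m)"
  by (rule tail_mult[OF Rad_tail]) simp

lemma zvar_tail: "z' p - l p *\<^sub>C 1 \<in> tail (Suc m)"
proof -
  obtain x1 x2 x3 where p: "p = (x1, x2, x3)" by (metis prod_cases3)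
  have "l p = of_real x1 + of_real x2 * c u e2 + of_real x3 * c u e3"
    by (simp add: l_def p zvar_def coord_add coord_scaleR coord_1[OF u])
  then have "z' p - l p *\<^sub>C 1 = x2 *\<^sub>R (I u * Rad n m I e2) + x3 *\<^sub>R (I u * Rad n m I e3)"
    by (simp add: p zvar_def e2' e3' scaleC_add_left scaleC_add_right scaleR_eq_scaleC scaleC_scaleC)
  then show ?thesis
    by (simp add: tail_add tail_scaleR idem_Rad_tail)
qed

lemma coord_z': "c u (z' p) = l p"
proof -
  have "c u (z' p - l p *\<^sub>C 1) = 0"
    using tailD[OF zvar_tail u_index] .
  then show ?thesis by (simp add: coord_diff coord_scaleC coord_1[OF u])
qed

lemma E3'_tail: "E3 e2' e3' \<subseteq> {h. h - c u h *\<^sub>C 1 \<in> tail (Suc m)}"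
  using zvar_tail coord_z' by (auto simp: E3_def)

text \<open>The reason for the form of the new vectors: multiplied by \<open>I u\<close>, they and
  the old ones leave the same scalar multiple of \<open>I u\<close> and the same nilpotent
  part.\<close>

lemma idem_mult_z': "I u * z' p = I u * z p"
proof -
  have "I u * e' = I u * e" if "e' = c u e *\<^sub>C 1 + I u * Rad n m I e" for e e'
  proof -
    have "I u * I u = I u" using idem_basis_mult u by simp
    then have "I u * e' = c u e *\<^sub>C I u + I u * Rad n m I e"
      unfolding that by (simp add: distrib_left scaleC_mult_right flip: mult.assoc)
    then show ?thesis using idem_mult[OF u, of e] by simp
  qed
  from this[OF e2'] this[OF e3'] show ?thesis
    by (cases p) (simp add: zvar_def distrib_left scaleR_eq_scaleC scaleC_mult_right)
qed

lemma U_eq: "U = {w \<in> E3 e2' e3'. c u w \<in> D}"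
  by (auto simp: U_def E3_def coord_z')

lemma z'_mem_U: "p \<in> P \<Longrightarrow> z' p \<in> U"
  using P_props(4) by (auto simp: U_def D_def)

text \<open>For connectedness, a linear section of \<open>l\<close> writes the coordinate preimage
  as an image of \<open>D\<close> times the kernel of \<open>l\<close>. Connectedness is then pushed
  forward by \<open>z'\<close>, so injectivity of \<open>z'\<close> is never an issue.\<close>

lemma domain_U: "domain_in (E3 e2' e3') U"
  unfolding domain_in_def
proof (intro conjI)
  have c: "continuous_on S (c u)" for S
    using bounded_linear.continuous_on[OF bounded_linear_coord[OF u_index(1)] continuous_on_id] .
  have "openin (top_of_set (E3 e2' e3')) (E3 e2' e3' \<inter> c u -` D)"
    by (rule continuous_openin_preimage[OF c, of _ UNIV]) (use open_D in auto)
  then show "openin (top_of_set (E3 e2' e3')) U"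
    by (simp add: U_eq vimage_def Int_def)
  show "U \<noteq> {}" using \<Omega>(3) by (auto simp: U_def D_def)
  obtain \<sigma> where \<sigma>: "linear \<sigma>" "l \<circ> \<sigma> = id"
    using linear_surjective_right_inverse[OF l_linear_surj] by blast
  have l\<sigma>: "l (\<sigma> w) = w" for w using \<sigma>(2) by (metis comp_apply id_apply)
  have "{p. l p \<in> D} = (\<lambda>(w, k). \<sigma> w + k) ` (D \<times> {k. l k = 0})"
  proof safe
    fix p assume "l p \<in> D"
    then have "(l p, p - \<sigma> (l p)) \<in> D \<times> {k. l k = 0}"
      by (simp add: linear_diff[OF l_linear_surj(1)] l\<sigma>)
    then show "p \<in> (\<lambda>(w, k). \<sigma> w + k) ` (D \<times> {k. l k = 0})"
      by (rule rev_image_eqI) simp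
  qed (simp add: linear_add[OF l_linear_surj(1)] l\<sigma>)
  moreover have "connected (D \<times> {k. l k = 0})"
  proof (intro connected_Times)
    show "connected D"
      unfolding D_def by (intro connected_continuous_image continuous_on_z \<Omega>)
    have "subspace {k. l k = 0}" using linear_subspace_kernel[OF l_linear_surj(1)] .
    then show "connected {k. l k = 0}" by (intro convex_connected subspace_imp_convex)
  qed
  moreover have "continuous_on (D \<times> {k. l k = 0}) (\<lambda>(w, k). \<sigma> w + k)"
    unfolding case_prod_unfold
    by (intro continuous_intros continuous_on_compose2[OF linear_continuous_on[of \<sigma> UNIV]])
       (use \<sigma>(1) in \<open>auto simp: linear_conv_bounded_linear\<close>)
  ultimately have "connected {p. l p \<in> D}"
    by (simp add: connected_continuous_image)
  then show "connected U"
    unfolding U_def by (intro connected_continuous_image continuous_on_z)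
qed

section \<open>Clearing the remainder coordinate by coordinate\<close>

definition rem :: "('a \<Rightarrow> 'a) \<Rightarrow> real \<times> real \<times> real \<Rightarrow> 'a" where
  "rem \<Theta> p = I u * (\<Phi> (z p) - \<Theta> (z' p))"

text \<open>The factor \<open>I u\<close> replaces \<open>z h\<close> by \<open>z' h\<close> in the
  derivative of \<Phi>, so the derivatives of both functions combine into one with the common
  direction \<open>z' h\<close>.\<close>

lemma rem_directional:
  assumes "monogenic_on B (E3 e2' e3') U \<Theta>" "p \<in> P"
  obtains d where "\<And>h. ((\<lambda>t. (rem \<Theta> (p + t *\<^sub>R h) - rem \<Theta> p) /\<^sub>R t) \<longlongrightarrow> z' h * d) (at_right 0)"
proof -
  obtain d where d: "\<And>h. h \<in> E3 e2 e3 \<Longrightarrow>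
      ((\<lambda>t. (\<Phi> (z p + t *\<^sub>R h) - \<Phi> (z p)) /\<^sub>R t) \<longlongrightarrow> h * d) (at_right 0)"
    using \<Phi> assms(2) unfolding monogenic_on_def P_def by blast
  obtain e where e: "\<And>h. h \<in> E3 e2' e3' \<Longrightarrow>
      ((\<lambda>t. (\<Theta> (z' p + t *\<^sub>R h) - \<Theta> (z' p)) /\<^sub>R t) \<longlongrightarrow> h * e) (at_right 0)"
    using assms(1) z'_mem_U[OF assms(2)] unfolding monogenic_on_def by blast
  note lin = linear_add[OF linear_zvar] linear_scale[OF linear_zvar]
  have "((\<lambda>t. (rem \<Theta> (p + t *\<^sub>R h) - rem \<Theta> p) /\<^sub>R t) \<longlongrightarrow> z' h * (I u * (d - e))) (at_right 0)" for h
  proof -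
    have "((\<lambda>t. I u * ((\<Phi> (z p + t *\<^sub>R z h) - \<Phi> (z p)) /\<^sub>R t - (\<Theta> (z' p + t *\<^sub>R z' h) - \<Theta> (z' p)) /\<^sub>R t))
        \<longlongrightarrow> I u * (z h * d - z' h * e)) (at_right 0)"
      by (intro bounded_linear.tendsto[OF bounded_linear_mult_right] tendsto_diff d e zvar_mem_E3)
    moreover have "I u * (z h * d - z' h * e) = z' h * (I u * (d - e))"
    proof -
      have "I u * (z h * d) = I u * (z' h * d)"
        by (simp add: idem_mult_z' flip: mult.assoc)
      then show ?thesis by (simp add: right_diff_distrib mult.left_commute)
    qed
    moreover have "I u * ((\<Phi> (z p + t *\<^sub>R z h) - \<Phi> (z p)) /\<^sub>R t - (\<Theta> (z' p + t *\<^sub>R z' h) - \<Theta> (z' p)) /\<^sub>R t)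
        = (rem \<Theta> (p + t *\<^sub>R h) - rem \<Theta> p) /\<^sub>R t" for t
      by (simp add: rem_def lin scaleR_eq_scaleC scaleC_mult_right algebra_simps
          cvec.scale_right_diff_distrib)
    ultimately show ?thesis by simp
  qed
  then show ?thesis using that by blast
qed

lemma continuous_on_rem:
  assumes "monogenic_on B (E3 e2' e3') U \<Theta>"
  shows "continuous_on P (rem \<Theta>)"
proof -
  have "continuous_on Q \<Phi>" "continuous_on U \<Theta>"
    using \<Phi> assms by (simp_all add: monogenic_on_def)
  then have "continuous_on P (\<lambda>p. \<Phi> (z p))" "continuous_on P (\<lambda>p. \<Theta> (z' p))"
    using z'_mem_U
    by (auto simp: P_def intro: continuous_on_compose2[OF _ continuous_on_z(1)]
        continuous_on_compose2[OF _ continuous_on_z(2)])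
  then show ?thesis
    unfolding rem_def by (intro continuous_on_mult_alg continuous_on_diff continuous_on_const)
qed

text \<open>The hypothesis \<open>mult\<close> isolates what has to be checked for a coordinate: its
  derivative sees the direction only through \<open>l h\<close>. This holds for the coordinate
  \<open>u\<close> and later for the first coordinate not yet cleared.\<close>

lemma coord_rem_factors:
  assumes \<Theta>: "monogenic_on B (E3 e2' e3') U \<Theta>" and i: "i \<in> {1..n}"
    and mult: "\<And>p h d. p \<in> P \<Longrightarrow>
        (\<And>h. ((\<lambda>t. (rem \<Theta> (p + t *\<^sub>R h) - rem \<Theta> p) /\<^sub>R t) \<longlongrightarrow> z' h * d) (at_right 0)) \<Longrightarrow>
        c i (z' h * d) = l h * c i d"
  shows "\<exists>G. G holomorphic_on D \<and> (\<forall>p\<in>P. c i (rem \<Theta> p) = G (l p))"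
proof -
  note ci = bounded_linear_coord[OF i]
  have "dir_diff l P (\<lambda>p. c i (rem \<Theta> p))"
    unfolding dir_diff_def
  proof
    fix p assume p: "p \<in> P"
    obtain d where d: "\<And>h. ((\<lambda>t. (rem \<Theta> (p + t *\<^sub>R h) - rem \<Theta> p) /\<^sub>R t) \<longlongrightarrow> z' h * d) (at_right 0)"
      using rem_directional[OF \<Theta> p] by blast
    have "((\<lambda>t. (c i (rem \<Theta> (p + t *\<^sub>R h)) - c i (rem \<Theta> p)) /\<^sub>R t) \<longlongrightarrow> l h * c i d) (at_right 0)" for h
      using bounded_linear.tendsto[OF ci d[of h]]
      by (simp add: coord_scaleR coord_diff scaleR_conv_of_real mult[OF p d])
    then show "\<exists>d. \<forall>h. ((\<lambda>t. (c i (rem \<Theta> (p + t *\<^sub>R h)) - c i (rem \<Theta> p)) /\<^sub>R t) \<longlongrightarrow> l h * d) (at_right 0)"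
      by blast
  qed
  moreover have "continuous_on P (\<lambda>p. c i (rem \<Theta> p))"
    using bounded_linear.continuous_on[OF ci continuous_on_rem[OF \<Theta>]] .
  moreover have "convex_in_direction {h. l h = 0} \<Omega>"
    using \<Omega>(4) by (simp add: l_def)
  ultimately show ?thesis
    using dir_diff_factors_extended[OF l_linear_surj P_props(1,2) _ _ \<Omega>(1,3) P_props(3) _ P_props(4)] unfolding D_def by metis
qed

lemma coord_idem_mult:
  assumes "k \<in> {1..m}" "k \<noteq> u"
  shows "c k (I u * x) = 0"
  using coord_multiplicative[OF assms(1), of "I u" x] coord_basis[of k u] assms u m_bounds by auto

text \<open>All semisimple coordinates of a multiple of \<open>I u\<close> vanish except the one
  with index \<open>u\<close>, so a single holomorphic function clears the semisimple part.\<close>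

lemma exists_first_approximation:
  obtains \<Theta> where "monogenic_on B (E3 e2' e3') U \<Theta>" "\<And>p. p \<in> P \<Longrightarrow> rem \<Theta> p \<in> tail (Suc m)"
proof -
  have cu: "c u (I u * x) = c u x" for x
    using coord_multiplicative[OF u, of "I u" x] coord_basis[OF u_index(1) u_index(1)] by simp
  have mono: "monogenic_on B (E3 e2' e3') U (taylor u G 1)" if "G holomorphic_on D" for G
    by (rule monogenic_on_taylor[OF u_index(1) that open_D domain_U _ E3'_tail]) (auto simp: U_eq)
  \<comment> \<open>The extension of the zero function serves as the zero approximant, so that its
    monogenicity is an instance of \<open>mono\<close>.\<close>
  have "\<exists>G. G holomorphic_on D \<and> (\<forall>p\<in>P. c u (rem (taylor u (\<lambda>_. 0) 1) p) = G (l p))"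
  proof (rule coord_rem_factors[OF mono u_index(1)])
    show "c u (z' h * d) = l h * c u d" for h d
      by (simp add: coord_multiplicative[OF u] coord_z')
  qed simp
  then obtain G where G: "G holomorphic_on D" "\<And>p. p \<in> P \<Longrightarrow> c u (rem (taylor u (\<lambda>_. 0) 1) p) = G (l p)"
    by blast
  have lead: "c u (taylor u G 1 (z' p)) = G (l p)" for G p
  proof -
    have "z' p - c u (z' p) *\<^sub>C 1 \<in> tail (Suc m)" using zvar_tail by (simp add: coord_z')
    from tailD[OF taylor_one_leading[OF this] u_index] show ?thesis
      by (simp add: coord_diff coord_scaleC coord_1[OF u] coord_z')
  qed
  have "rem (taylor u G 1) p \<in> tail (Suc m)" if "p \<in> P" for p
    unfolding tail_def
  proof safe
    fix k assume k: "k \<in> {1..n}" "k < Suc m"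
    show "c k (rem (taylor u G 1) p) = 0"
    proof (cases "k = u")
      case True
      then show ?thesis using G(2)[OF that] by (simp add: rem_def cu coord_diff lead)
    next
      case False
      then show ?thesis unfolding rem_def using k by (intro coord_idem_mult) auto
    qed
  qed
  then show ?thesis using that mono[OF G(1)] by blast
qed

text \<open>If \<open>I u\<close> kills \<open>I j\<close>, the coordinate \<open>j\<close> of any
  multiple of \<open>I u\<close> is 0 and nothing changes. Otherwise this coordinate is a
  holomorphic function of f_u, and its Taylor extension along \<open>I j\<close> is added to the
  approximant.\<close>

lemma exists_next_approximation:
  assumes \<Theta>: "monogenic_on B (E3 e2' e3') U \<Theta>" "\<And>p. p \<in> P \<Longrightarrow> rem \<Theta> p \<in> tail j"
    and j: "m < j" "j \<le> n"
  obtains \<Theta>' where "monogenic_on B (E3 e2' e3') U \<Theta>'" "\<And>p. p \<in> P \<Longrightarrow> rem \<Theta>' p \<in> tail (Suc j)"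
proof -
  have jn: "j \<in> {1..n}" "j \<in> {m+1..n}" using j by auto
  have step: "x \<in> tail (Suc j)" if "x \<in> tail j" "c j x = 0" for x
    using that by (auto simp: tail_def less_Suc_eq)
  consider (zero) "I u * I j = 0" | (unit) "I u * I j = I j"
    using idem_nil[OF u jn(2)] by blast
  then show ?thesis
  proof cases
    case zero
    have "c j (I u * x) = 0" for x
    proof -
      have "c j (I u * I l) = 0" if l: "l \<in> {1..n}" for l
      proof (cases "l = j")
        case False
        then show ?thesis
          using l u jn by (cases "l \<le> m") (auto simp: idem_basis_mult coord_basis coord_basis_mult_idem)
      qed (use zero in simp)
      then show ?thesis
        by (subst expand[of x]) (simp add: sum_distrib_left coord_sum scaleC_mult_right coord_scaleC)
    qed
    then have "rem \<Theta> p \<in> tail (Suc j)" if "p \<in> P" for p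
      using \<Theta>(2)[OF that] by (intro step) (auto simp: rem_def)
    then show ?thesis using that \<Theta>(1) by blast
  next
    case unit
    have "\<exists>G. G holomorphic_on D \<and> (\<forall>p\<in>P. c j (rem \<Theta> p) = G (l p))"
    proof (rule coord_rem_factors[OF \<Theta>(1) jn(1)])
      fix p h d assume p: "p \<in> P"
        and d: "\<And>h. ((\<lambda>t. (rem \<Theta> (p + t *\<^sub>R h) - rem \<Theta> p) /\<^sub>R t) \<longlongrightarrow> z' h * d) (at_right 0)"
      \<comment> \<open>In the direction 1 the limit is \<open>d\<close> itself; the difference
        quotients lie in \<open>tail j\<close>, and hence so does \<open>d\<close>.\<close>
      have "d \<in> tail j"
        unfolding tail_def
      proof safe
        fix i assume i: "i \<in> {1..n}" "i < j"
        have "z' (1, 0, 0) = 1" by (simp add: zvar_def)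
        then obtain e where e: "z' e = 1" by blast
        have "((\<lambda>t. (rem \<Theta> (p + t *\<^sub>R e) - rem \<Theta> p) /\<^sub>R t) \<longlongrightarrow> d) (at_right 0)"
          using d[of e] by (simp add: e)
        then have lim: "((\<lambda>t. c i ((rem \<Theta> (p + t *\<^sub>R e) - rem \<Theta> p) /\<^sub>R t)) \<longlongrightarrow> c i d) (at_right 0)"
          by (rule bounded_linear.tendsto[OF bounded_linear_coord[OF i(1)]])
        have "((\<lambda>t. p + t *\<^sub>R e) \<longlongrightarrow> p + 0 *\<^sub>R e) (at_right 0)"
          by (intro tendsto_intros)
        then have "\<forall>\<^sub>F t in at_right 0. p + t *\<^sub>R e \<in> P"
          using P_props(1) p by (simp add: topological_tendstoD)
        then have "\<forall>\<^sub>F t in at_right 0. c i ((rem \<Theta> (p + t *\<^sub>R e) - rem \<Theta> p) /\<^sub>R t) = 0"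
        proof eventually_elim
          case (elim t)
          show ?case
            using tailD[OF \<Theta>(2)[OF elim] i] tailD[OF \<Theta>(2)[OF p] i] by (simp add: coord_scaleR coord_diff)
        qed
        from Lim_transform_eventually[OF lim this] show "c i d = 0"
          using tendsto_unique[OF _ _ tendsto_const] by (metis trivial_limit_at_right_real)
      qed
      \<comment> \<open>The nilpotent part of the direction pushes \<open>d\<close> past the
        coordinate \<open>j\<close>, so only the scalar \<open>l h\<close> contributes
        there.\<close>
      then have "(z' h - l h *\<^sub>C 1) * d \<in> tail (Suc j)"
        by (intro tail_mult_Suc zvar_tail j)
      from tailD[OF this jn(1)] have "c j ((z' h - l h *\<^sub>C 1) * d) = 0" by simp
      then show "c j (z' h * d) = l h * c j d"
        by (simp add: left_diff_distrib scaleC_mult_left coord_diff coord_scaleC)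
    qed
    then obtain G where G: "G holomorphic_on D" "\<And>p. p \<in> P \<Longrightarrow> c j (rem \<Theta> p) = G (l p)"
      by blast
    have Ij: "I j \<in> tail j" using tail_basis jn by blast
    define \<Theta>' where "\<Theta>' \<zeta> = \<Theta> \<zeta> + taylor u G (I j) \<zeta>" for \<zeta>
    have "monogenic_on B (E3 e2' e3') U (taylor u G (I j))"
      by (rule monogenic_on_taylor[OF u_index(1) G(1) open_D domain_U _ E3'_tail])
         (use Ij tail_mono[of "Suc m" j] j in \<open>auto simp: U_eq\<close>)
    then have "monogenic_on B (E3 e2' e3') U \<Theta>'"
      unfolding \<Theta>'_def by (intro monogenic_on_add \<Theta>)
    moreover have "rem \<Theta>' p \<in> tail (Suc j)" if p: "p \<in> P" for p
    proof -
      \<comment> \<open>The error of the leading term; since it lies in \<open>tail (Suc j)\<close>,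
        the correction cancels the coordinate \<open>j\<close> without reviving lower ones.\<close>
      define x where "x = taylor u G (I j) (z' p) - G (l p) *\<^sub>C I j"
      have "x \<in> tail (Suc j)"
        unfolding x_def using taylor_tail_leading[of "z' p" u "I j" j G] zvar_tail[of p] Ij j by (simp add: coord_z')
      then have "I u * x \<in> tail (Suc j)" using j by (intro tail_mult) auto
      moreover have "rem \<Theta> p - G (l p) *\<^sub>C I j \<in> tail (Suc j)"
        using G(2)[OF p] coord_basis[OF jn(1) jn(1)]
        by (intro step tail_diff \<Theta>(2) p tail_scaleC Ij) (simp add: coord_diff coord_scaleC)
      ultimately have "rem \<Theta> p - G (l p) *\<^sub>C I j - I u * x \<in> tail (Suc j)"
        by (rule tail_diff[rotated])
      moreover have "rem \<Theta> p - G (l p) *\<^sub>C I j - I u * x = rem \<Theta>' p"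
        by (simp add: rem_def \<Theta>'_def x_def distrib_left right_diff_distrib scaleC_mult_right unit)
      ultimately show ?thesis by simp
    qed
    ultimately show ?thesis using that by blast
  qed
qed

lemma exists_transfer:
  obtains \<Theta> where "monogenic_on B (E3 e2' e3') U \<Theta>" "\<And>p. p \<in> P \<Longrightarrow> I u * \<Phi> (z p) = I u * \<Theta> (z' p)"
proof -
  have "\<exists>\<Theta>. monogenic_on B (E3 e2' e3') U \<Theta> \<and> (\<forall>p\<in>P. rem \<Theta> p \<in> tail (Suc k))"
    if "m \<le> k" "k \<le> n" for k
    using that
  proof (induction k rule: dec_induct)
    case base
    show ?case by (rule exists_first_approximation) blast
  next
    case (step k)
    then obtain \<Theta> where \<Theta>: "monogenic_on B (E3 e2' e3') U \<Theta>" "\<And>p. p \<in> P \<Longrightarrow> rem \<Theta> p \<in> tail (Suc k)"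
      by auto
    have k: "m < Suc k" "Suc k \<le> n" using step by auto
    show ?case by (rule exists_next_approximation[OF \<Theta> k]) blast+
  qed
  from this[OF m_bounds(2) order_refl]
  obtain \<Theta> where \<Theta>: "monogenic_on B (E3 e2' e3') U \<Theta>" "\<And>p. p \<in> P \<Longrightarrow> rem \<Theta> p \<in> tail (Suc n)"
    by blast
  have "I u * \<Phi> (z p) = I u * \<Theta> (z' p)" if "p \<in> P" for p
    using tail_eq_0[OF \<Theta>(2)[OF that]] by (simp add: rem_def right_diff_distrib)
  then show ?thesis using that \<Theta>(1) by blast
qed

end

theorem mainTheorem1:
  fixes I :: "nat \<Rightarrow> 'a::complex_comm_algebra_1" and n m N :: nat
    and a b :: "nat \<Rightarrow> complex" and e2 e3 :: 'a
    and C :: "nat \<Rightarrow> nat \<Rightarrow> nat \<Rightarrow> real"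
    and \<Omega> :: "(real \<times> real \<times> real) set"
    and \<Pi>\<^sub>\<zeta> :: "'a set" and \<Phi> :: "'a \<Rightarrow> 'a"
  assumes "cartan_basis n m I"
    and "e2 = (\<Sum>r=1..n. a r *\<^sub>C I r)"
    and "e3 = (\<Sum>r=1..n. b r *\<^sub>C I r)"
    and "distinct [1, e2, e3]" and "independent {1, e2, e3}"
    and "N > 0" and "char_poly3 N C 1 e2 e3 = 0"
    and "\<forall>u\<in>{1..m}. coord n I u ` E3 e2 e3 = UNIV"
    and "domain_in UNIV \<Omega>"
    and "\<forall>u\<in>{1..m}. convex_in_direction (dir_line (a u) (b u)) \<Omega>"
    and "\<Pi>\<^sub>\<zeta> = (\<Inter>u\<in>{1..m}. cylinder n I e2 e3 \<Omega> u)"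
    and "domain_in (E3 e2 e3) \<Pi>\<^sub>\<zeta>"
    and "monogenic_on UNIV (E3 e2 e3) \<Pi>\<^sub>\<zeta> \<Phi>"
  shows "\<forall>u\<in>{1..m}. \<exists>e2' e3' :: 'a.
           e2' = a u *\<^sub>C 1 + I u * Rad n m I e2 \<and>
           e3' = b u *\<^sub>C 1 + I u * Rad n m I e3 \<and>
           e2' \<in> unital_nil_subalgebra n m I \<and> e3' \<in> unital_nil_subalgebra n m I \<and>
           char_poly3 N C 1 e2' e3' = 0 \<and>
           (\<exists>\<Phi>' :: 'a \<Rightarrow> 'a.
              monogenic_on (unital_nil_subalgebra n m I) (E3 e2' e3')
                {w \<in> E3 e2' e3'. \<exists>\<zeta>\<in>cylinder n I e2 e3 \<Omega> u. coord n I u w = coord n I u \<zeta>} \<Phi>' \<and>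
              (\<forall>p. zvar e2 e3 p \<in> \<Pi>\<^sub>\<zeta> \<longrightarrow>
                 I u * \<Phi> (zvar e2 e3 p) = I u * \<Phi>' (zvar e2' e3' p)))"
proof
  fix u assume u: "u \<in> {1..m}"
  interpret cartan_algebra n m I by unfold_locales fact
  have "u \<in> {1..n}" using u m_bounds by auto
  then have a: "c u e2 = a u" and b: "c u e3 = b u"
    unfolding assms(2,3) by (simp_all only: coord_sum_basis[OF _ order_refl] if_True)
  define e2' e3' where "e2' = a u *\<^sub>C 1 + I u * Rad n m I e2" and "e3' = b u *\<^sub>C 1 + I u * Rad n m I e3"
  \<comment> \<open>The real and imaginary parts of f_u(\<zeta>) = 0 are the two equations of the
    line L_u.\<close>
  have dir: "dir_line (a u) (b u) = {p. c u (zvar e2 e3 p) = 0}"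
    by (auto simp: dir_line_def zvar_def coord_add coord_scaleR coord_1[OF u] a b complex_eq_iff)
  have \<Omega>: "open \<Omega>" "connected \<Omega>" "\<Omega> \<noteq> {}"
    using assms(9) by (auto simp: domain_in_def)
  interpret monogenic_cylinder n m I u e2 e3 e2' e3' \<Omega> \<Pi>\<^sub>\<zeta> \<Phi>
  proof
    show "e2' = c u e2 *\<^sub>C 1 + I u * Rad n m I e2" "e3' = c u e3 *\<^sub>C 1 + I u * Rad n m I e3"
      by (simp_all add: e2'_def e3'_def a b)
    show "inj (zvar e2 e3)" by (rule inj_zvar) fact+
    show "c u ` E3 e2 e3 = UNIV" using assms(8) u by blast
    show "convex_in_direction {p. c u (zvar e2 e3 p) = 0} \<Omega>"
      using assms(10) u unfolding dir[symmetric] by blast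
    show "\<Omega> \<subseteq> {p. zvar e2 e3 p \<in> \<Pi>\<^sub>\<zeta>}"
      unfolding assms(11) cylinder_def using zvar_mem_E3 by blast
    show "c u ` \<Pi>\<^sub>\<zeta> \<subseteq> c u ` zvar e2 e3 ` \<Omega>"
      unfolding assms(11) cylinder_def using u by blast
  qed (use u \<Omega> assms(13) in auto)
  obtain \<Theta> where \<Theta>: "monogenic_on B (E3 e2' e3') U \<Theta>" "\<And>p. p \<in> P \<Longrightarrow> I u * \<Phi> (z p) = I u * \<Theta> (z' p)"
    using exists_transfer by blast
  have "U = {w \<in> E3 e2' e3'. \<exists>\<zeta>\<in>cylinder n I e2 e3 \<Omega> u. c u w = c u \<zeta>}"
  proof -
    have "d \<in> D \<longleftrightarrow> (\<exists>\<zeta>\<in>cylinder n I e2 e3 \<Omega> u. d = c u \<zeta>)" for d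
    proof
      assume "d \<in> D"
      then obtain p where "p \<in> \<Omega>" "d = c u (z p)" by (auto simp: D_def l_def)
      then show "\<exists>\<zeta>\<in>cylinder n I e2 e3 \<Omega> u. d = c u \<zeta>"
        by (intro bexI[of _ "z p"]) (auto simp: cylinder_def zvar_mem_E3)
    qed (auto simp: cylinder_def D_def l_def)
    then show ?thesis by (simp add: U_eq)
  qed
  moreover have "e2' \<in> B" "e3' \<in> B"
    unfolding e2'_def e3'_def by (intro unital_nil_memI idem_Rad_tail)+
  moreover have "char_poly3 N C 1 e2' e3' = 0"
    using char_poly3_transfer[OF u assms(7)] by (simp add: e2'_def e3'_def a b)
  ultimately show "\<exists>e2' e3'. e2' = a u *\<^sub>C 1 + I u * Rad n m I e2 \<and>
           e3' = b u *\<^sub>C 1 + I u * Rad n m I e3 \<and>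
           e2' \<in> unital_nil_subalgebra n m I \<and> e3' \<in> unital_nil_subalgebra n m I \<and>
           char_poly3 N C 1 e2' e3' = 0 \<and>
           (\<exists>\<Phi>'.
              monogenic_on (unital_nil_subalgebra n m I) (E3 e2' e3')
                {w \<in> E3 e2' e3'. \<exists>\<zeta>\<in>cylinder n I e2 e3 \<Omega> u. coord n I u w = coord n I u \<zeta>} \<Phi>' \<and>
              (\<forall>p. zvar e2 e3 p \<in> \<Pi>\<^sub>\<zeta> \<longrightarrow>
                 I u * \<Phi> (zvar e2 e3 p) = I u * \<Phi>' (zvar e2' e3' p)))"
    using \<Theta> unfolding e2'_def[symmetric] e3'_def[symmetric] P_def by auto
qed

end
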